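(* Let $U$ be Haar-distributed on $\mathcal{U}(d)$. Then (i) for odd $d$, with single-qudit displacement operators ($n=1$, $d_L=d$): $\mathbb{E}_U[H_2(U)]=1-\frac{3(d^4-4d^2+2)}{d^4(d^2-4)}$; (ii) for even $d$, with single-qudit displacement operators ($n=1$, $d_L=d$): $\mathbb{E}_U[H_2(U)]=1-\frac{3(d^4-10d^2+10)}{d^2(d^2-9)(d^2-1)}$; (iii) for $d=2^n$ with $n$-qubit displacement operators ($d_L=2$): $\mathbb{E}_U[H_2(U)]=1-\frac{4(d^4-9d^2+6)}{d^4(d^2-9)}$. In particular $\mathbb{E}_U[H_2(U)]=1-O(1/d^2)$.
   Context: On $\mathbb{C}^{d_L}$ let $Z|k\rangle=\omega^k|k\rangle$, $X|k\rangle=|k+1\rangle$ (mod $d_L$), $\omega=e^{2\pi i/d_L}$, $\tau=-e^{i\pi/d_L}$, $D_{(a_1,a_2)}=\tau^{a_1a_2}X^{a_1}Z^{a_2}$, and for $\mathbf a=\mathbf a_1\oplus\cdots\oplus\mathbf a_n\in\mathbb{Z}_{d_L}^{2n}$ let $D_{\mathbf a}=D_{\mathbf a_1}\otimes\cdots\otimes D_{\mathbf a_n}$ acting on $\mathbb{C}^d$, $d=d_L^n$. The 2-Clifford entropy of a unitary $U$ is $H_2(U)=1-\frac{1}{d^6}\sum_{\mathbf a,\mathbf b}\big|\operatorname{tr}(D_{\mathbf a}^\dagger UD_{\mathbf b}U^\dagger)\big|^4$. *)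

theory Defs
  imports "HOL-Probability.Probability"
begin

text \<open>Square d x d complex matrices are represented as extensional functions on
  the index set {0..<d} x {0..<d} (the measurable space is the product sigma-algebra
  of Borel sets of the complex numbers, i.e. the Borel sigma-algebra on C^(d x d)).\<close>

type_synonym cmatrix = "nat \<times> nat \<Rightarrow> complex"

definition idx :: "nat \<Rightarrow> (nat \<times> nat) set" where
  "idx d = {0..<d} \<times> {0..<d}"

definition mat_space :: "nat \<Rightarrow> cmatrix measure" where
  "mat_space d = PiM (idx d) (\<lambda>_. borel)"

definition mmul :: "nat \<Rightarrow> cmatrix \<Rightarrow> cmatrix \<Rightarrow> cmatrix" where
  "mmul d A B = restrict (\<lambda>(i,j). \<Sum>k<d. A (i,k) * B (k,j)) (idx d)"

definition adj :: "nat \<Rightarrow> cmatrix \<Rightarrow> cmatrix" where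
  "adj d A = restrict (\<lambda>(i,j). cnj (A (j,i))) (idx d)"

definition idm :: "nat \<Rightarrow> cmatrix" where
  "idm d = restrict (\<lambda>(i,j). if i = j then 1 else 0) (idx d)"

definition mtrace :: "nat \<Rightarrow> cmatrix \<Rightarrow> complex" where
  "mtrace d A = (\<Sum>i<d. A (i,i))"

definition unitary_mat :: "nat \<Rightarrow> cmatrix \<Rightarrow> bool" where
  "unitary_mat d U \<longleftrightarrow> U \<in> extensional (idx d) \<and> mmul d (adj d U) U = idm d"

definition haar_measure :: "nat \<Rightarrow> cmatrix measure \<Rightarrow> bool" where
  "haar_measure d M \<longleftrightarrow>
     prob_space M \<and> sets M = sets (mat_space d) \<and>
     (AE U in M. unitary_mat d U) \<and>
     (\<forall>V. unitary_mat d V \<longrightarrow> distr M M (mmul d V) = M)"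

text \<open>Single-qudit Heisenberg-Weyl operators on C^dL:
  D_(a1,a2) = tau^(a1 a2) X^a1 Z^a2, with Z|k> = omega^k |k>, X|k> = |k+1 mod dL>.
  Entry (r,c) of X^a1 Z^a2 is omega^(a2 c) [r = c + a1 mod dL].
  Components a1, a2 are taken as representatives in {0..<dL}.\<close>

definition omega :: "nat \<Rightarrow> complex" where
  "omega dL = exp (2 * pi * \<i> / of_nat dL)"

definition tau :: "nat \<Rightarrow> complex" where
  "tau dL = - exp (pi * \<i> / of_nat dL)"

definition Dq :: "nat \<Rightarrow> nat \<times> nat \<Rightarrow> nat \<Rightarrow> nat \<Rightarrow> complex" where
  "Dq dL a r c = (tau dL) ^ (fst a * snd a) * (omega dL) ^ (snd a * c) *
      (if r = (c + fst a) mod dL then 1 else 0)"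

text \<open>Digit j (base dL) of a basis index k of (C^dL)^(tensor n) = C^(dL^n).\<close>

definition digit :: "nat \<Rightarrow> nat \<Rightarrow> nat \<Rightarrow> nat" where
  "digit dL j k = (k div dL ^ j) mod dL"

text \<open>n-qudit displacement operator D_a = D_a_0 tensor ... tensor D_a_(n-1),
  for a in Z_dL^(2n), represented as a : {0..<n} -> Z_dL x Z_dL.\<close>

definition Dmat :: "nat \<Rightarrow> nat \<Rightarrow> (nat \<Rightarrow> nat \<times> nat) \<Rightarrow> cmatrix" where
  "Dmat dL n a = restrict (\<lambda>(r,c). \<Prod>j<n. Dq dL (a j) (digit dL j r) (digit dL j c))
                   (idx (dL ^ n))"

definition phase_points :: "nat \<Rightarrow> nat \<Rightarrow> (nat \<Rightarrow> nat \<times> nat) set" where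
  "phase_points dL n = PiE {..<n} (\<lambda>_. {..<dL} \<times> {..<dL})"

definition H2 :: "nat \<Rightarrow> nat \<Rightarrow> cmatrix \<Rightarrow> real" where
  "H2 dL n U = (let d = dL ^ n in
     1 - (1 / real d ^ 6) *
       (\<Sum>a\<in>phase_points dL n. \<Sum>b\<in>phase_points dL n.
          (cmod (mtrace d (mmul d (mmul d (adj d (Dmat dL n a)) U)
                                  (mmul d (Dmat dL n b) (adj d U))))) ^ 4))"

end

theory Submission
  imports Defs
begin

text \<open>
  The fourth moment \<open>\<bar>tr(A\<^sup>* U B U\<^sup>*)\<bar>\<^sup>4\<close> is linear in \<open>U\<^bsup>\<otimes>4\<^esup> (B \<otimes> B \<otimes> B\<^sup>* \<otimes> B\<^sup>*) U\<^bsup>*\<otimes>4\<^esup>\<close>,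
  whose expectation \<open>T\<close> commutes with \<open>V\<^bsup>\<otimes>4\<^esup>\<close> for every unitary \<open>V\<close>.  Taking \<open>V = 1 + w P\<close> with a
  projection \<open>P\<close> and comparing coefficients of \<open>w\<close>, \<open>T\<close> commutes with the action of all
  matrix units and hence with every symmetrised elementary tensor.  Summing this over the basis gives
  \<open>T \<Gamma> = \<Sum>\<^sub>p tr(T P\<^sub>p\<^sup>-\<^sup>1) P\<^sub>p\<close>, where \<open>P\<^sub>p\<close> permutes the tensor factors and
  \<open>\<Gamma> = \<Sum>\<^sub>p d\<^bsup>#cycles(p)\<^esup> P\<^sub>p\<close>.  Inverting \<open>\<Gamma>\<close> (as an element of the group algebra for \<open>d \<ge> 4\<close>, only as
  an operator for \<open>d \<le> 3\<close>) expresses the moment of two traceless unitaries \<open>A\<close>, \<open>B\<close> through \<open>d\<close>,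
  \<open>\<bar>tr A\<^sup>2\<bar>\<^sup>2\<close> and \<open>\<bar>tr B\<^sup>2\<bar>\<^sup>2\<close>.  For displacement operators \<open>\<Sum>\<^sub>a \<bar>tr D\<^sub>a\<^sup>2\<bar>\<^sup>2 = \<kappa> d\<^sup>2\<close> with
  \<open>\<kappa> = #{a. 2a = 0}\<close>, which is 1, 4 or \<open>d\<^sup>2\<close> in the three cases.
\<close>

section \<open>Permutations of four tensor factors\<close>

text \<open>Since the adjoint of U B U* is U B* U*, all four tensor sites are conjugated by the same
  U. No conjugate representation enters, and permutations of the factors suffice to describe
  \<open>T\<close>. The relation for T \<Gamma> stands in for the double commutant theorem: it gives
  the coefficients of \<open>T\<close> as soon as \<Gamma> can be inverted. The obstacle is small
  dimension. The closed Weingarten values have the denominator d^2 (d^2-1) (d^2-4) (d^2-9), while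
  the final formulas are regular at the dimensions they cover. So d = 1, 2, 3 need coefficients of
  their own, which invert \<Gamma> only on actual index tuples. Tracelessness kills every
  permutation with a fixed point, leaving 9 of 24. With x and y the values of \<bar>tr A^2\<bar>^2
  and \<bar>tr B^2\<bar>^2, the moment has the shape c0 + c1 (x + y) + W(1) x y, so summing over all
  pairs of displacement operators takes only the sum of x. The zero displacement, which is the
  identity and not traceless, is split off and computed directly.\<close>

definition act :: "'a list \<Rightarrow> nat list \<Rightarrow> 'a list" where
  "act x p = map ((!) x) p"

text \<open>One-line notation: \<open>p\<close> stands for the map sending \<open>m\<close> to
  \<open>p ! m\<close>. Then \<open>act p q\<close> is the composite of \<open>p\<close> after
  \<open>q\<close>, and the same function \<open>act\<close> is a right action on tuples. Being
  concrete lists, the 24 elements can be enumerated, and most facts about them are settled by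
  evaluation.\<close>

definition S4 :: "nat list set" where
  "S4 = {p. distinct p \<and> set p = {0,1,2,3}}"

definition tuples :: "nat \<Rightarrow> nat list set" where
  "tuples d = {x. length x = 4 \<and> set x \<subseteq> {..<d}}"

lemma act_simps [simp]:
  "act x [] = []" "act x (i # p) = x ! i # act x p"
  by (simp_all add: act_def)

lemma length_act [simp]: "length (act x p) = length p"
  by (simp add: act_def)

lemma act_assoc: "set q \<subseteq> {..<length p} \<Longrightarrow> act (act x p) q = act x (act p q)"
  by (auto simp: act_def)

lemma S4_length: "p \<in> S4 \<Longrightarrow> length p = 4"
  unfolding S4_def by (auto dest: distinct_card)

lemma S4_set: "p \<in> S4 \<Longrightarrow> set p = {..<4}"
  unfolding S4_def by auto

lemma act_in_S4: "p \<in> S4 \<Longrightarrow> q \<in> S4 \<Longrightarrow> act p q \<in> S4"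
  unfolding S4_def act_def
proof (clarsimp, intro conjI)
  assume p: "distinct p" "set p = {0,Suc 0,2,3}" and q: "distinct q" "set q = {0,Suc 0,2,3}"
  have l: "length p = 4" using p distinct_card[of p] by simp
  show "distinct (map ((!) p) q)"
    using p q l by (auto simp: distinct_map inj_on_def nth_eq_iff_index_eq)
  have "{0,Suc 0,2,3} = {..<length p}" using l by auto
  then have "(!) p ` {0,Suc 0,2,3} = set p"
    by (metis atLeast_upt list.set_map map_nth)
  then show "{p ! 0, p ! Suc 0, p ! 2, p ! 3} = {0, Suc 0, 2, 3}" using p by simp
qed

lemma act_in_tuples: "x \<in> tuples d \<Longrightarrow> p \<in> S4 \<Longrightarrow> act x p \<in> tuples d"
  using S4_set[of p] S4_length[of p]
  by (auto simp: tuples_def act_def) (metis lessThan_iff nth_mem subsetD)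

lemma S4_explicit:
  "S4 = set [[0,1,2,3],[0,1,3,2],[0,2,1,3],[0,2,3,1],[0,3,1,2],[0,3,2,1],
             [1,0,2,3],[1,0,3,2],[1,2,0,3],[1,2,3,0],[1,3,0,2],[1,3,2,0],
             [2,0,1,3],[2,0,3,1],[2,1,0,3],[2,1,3,0],[2,3,0,1],[2,3,1,0],
             [3,0,1,2],[3,0,2,1],[3,1,0,2],[3,1,2,0],[3,2,0,1],[3,2,1,0]]" (is "_ = set ?L")
proof
  show "set ?L \<subseteq> S4" by (auto simp: S4_def)
  show "S4 \<subseteq> set ?L"
  proof
    fix p assume p: "p \<in> S4"
    then obtain a b c e where pe: "p = [a,b,c,e]"
      using S4_length[OF p] by (auto simp: length_Suc_conv numeral_eq_Suc)
    have "distinct [a,b,c,e]" using p unfolding pe S4_def by blast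
    moreover have "a \<in> set p" "b \<in> set p" "c \<in> set p" "e \<in> set p" unfolding pe by simp_all
    then have "a \<in> {0,1,2,3}" "b \<in> {0,1,2,3}" "c \<in> {0,1,2,3}" "e \<in> {0,1,2,3}"
      using p unfolding S4_def by (metis (lifting) mem_Collect_eq)+
    moreover have "\<forall>a\<in>{0,1,2,3}. \<forall>b\<in>{0,1,2,3}. \<forall>c\<in>{0,1,2,3}. \<forall>e\<in>{0,1,2,3}.
        distinct [a,b,c,e] \<longrightarrow> [a,b,c,e] \<in> set ?L"
      by simp
    ultimately have "[a,b,c,e] \<in> set ?L" by (metis (no_types, lifting))
    then show "p \<in> set ?L" unfolding pe .
  qed
qed

lemma finite_S4 [simp]: "finite S4" unfolding S4_explicit by (rule finite_set)

lemma sum_S4: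
  "(\<Sum>p\<in>S4. f p) =
     f [0,1,2,3] + f [0,1,3,2] + f [0,2,1,3] + f [0,2,3,1] + f [0,3,1,2] + f [0,3,2,1] +
     f [1,0,2,3] + f [1,0,3,2] + f [1,2,0,3] + f [1,2,3,0] + f [1,3,0,2] + f [1,3,2,0] +
     f [2,0,1,3] + f [2,0,3,1] + f [2,1,0,3] + f [2,1,3,0] + f [2,3,0,1] + f [2,3,1,0] +
     f [3,0,1,2] + f [3,0,2,1] + f [3,1,0,2] + f [3,1,2,0] + f [3,2,0,1] + f [3,2,1,0]"
  for f :: "nat list \<Rightarrow> 'a :: comm_monoid_add"
  unfolding S4_explicit by (subst sum.distinct_set_conv_list) (simp_all add: add_ac)

lemma finite_tuples [simp]: "finite (tuples d)"
proof -
  have "tuples d = {x. set x \<subseteq> {..<d} \<and> length x = 4}" by (auto simp: tuples_def)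
  then show ?thesis by (simp add: finite_lists_length_eq)
qed

lemma sum_tuples:
  "(\<Sum>x\<in>tuples d. f x) = (\<Sum>i<d. \<Sum>j<d. \<Sum>k<d. \<Sum>l<d. f [i,j,k,l])"
  for f :: "nat list \<Rightarrow> 'a :: comm_monoid_add"
proof -
  have "(\<Sum>x\<in>tuples d. f x) =
      (\<Sum>(i,j,k,l)\<in>{..<d}\<times>{..<d}\<times>{..<d}\<times>{..<d}. f [i,j,k,l])"
    by (rule sum.reindex_bij_witness[of _ "\<lambda>(i,j,k,l). [i,j,k,l]" "\<lambda>x. (x!0,x!1,x!2,x!3)"])
       (auto simp: tuples_def length_Suc_conv numeral_eq_Suc)
  then show ?thesis by (simp add: sum.cartesian_product case_prod_unfold)
qed

text \<open>The inverse in one-line notation: the length of the prefix before \<open>m\<close> is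
  the position of \<open>m\<close> in \<open>p\<close>.\<close>

definition pinv :: "nat list \<Rightarrow> nat list" where
  "pinv p = map (\<lambda>m. length (takeWhile (\<lambda>i. i \<noteq> m) p)) [0,1,2,3]"

lemma pinv:
  assumes "p \<in> S4"
  shows "pinv p \<in> S4" "act p (pinv p) = [0,1,2,3]" "act (pinv p) p = [0,1,2,3]"
proof -
  have "\<forall>p\<in>S4. pinv p \<in> S4 \<and> act p (pinv p) = [0,1,2,3] \<and> act (pinv p) p = [0,1,2,3]"
    unfolding S4_explicit by (simp add: pinv_def)
  then show "pinv p \<in> S4" "act p (pinv p) = [0,1,2,3]" "act (pinv p) p = [0,1,2,3]"
    using assms by auto
qed

lemma act_id: "length x = 4 \<Longrightarrow> act x [0,1,2,3] = x"
  by (auto simp: length_Suc_conv numeral_eq_Suc)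

lemma act_assoc_S4: "p \<in> S4 \<Longrightarrow> q \<in> S4 \<Longrightarrow> act (act x p) q = act x (act p q)"
  by (rule act_assoc) (simp add: S4_set S4_length)

lemma sum_tuples_act:
  assumes p: "p \<in> S4"
  shows "(\<Sum>x\<in>tuples d. f x) = (\<Sum>x\<in>tuples d. f (act x p))"
proof (rule sum.reindex_bij_witness[of _ "\<lambda>x. act x p" "\<lambda>x. act x (pinv p)"])
  fix x assume x: "x \<in> tuples d"
  then have l: "length x = 4" by (simp add: tuples_def)
  show "act (act x (pinv p)) p = x" "act (act x p) (pinv p) = x"
    using pinv[OF p] p l by (simp_all only: act_assoc_S4 act_id)
  then show "f (act (act x (pinv p)) p) = f x" by simp
  show "act x p \<in> tuples d" "act x (pinv p) \<in> tuples d"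
    using x p pinv(1)[OF p] by (simp_all only: act_in_tuples)
qed

lemma id_act: "p \<in> S4 \<Longrightarrow> act [0,1,2,3] p = p"
proof -
  have "\<forall>p\<in>S4. act [0,1,2,3] p = p" unfolding S4_explicit by simp
  then show "p \<in> S4 \<Longrightarrow> act [0,1,2,3] p = p" by blast
qed

lemma sum_S4_act:
  assumes s: "s \<in> S4"
  shows "(\<Sum>p\<in>S4. f p) = (\<Sum>p\<in>S4. f (act s p))"
proof (rule sum.reindex_bij_witness[of _ "act s" "act (pinv s)"])
  fix p assume p: "p \<in> S4"
  show "act s (act (pinv s) p) = p" "act (pinv s) (act s p) = p"
    using pinv[OF s] s p by (simp_all only: act_assoc_S4[symmetric] id_act)
  then show "f (act s (act (pinv s) p)) = f p" by simp
  show "act s p \<in> S4" "act (pinv s) p \<in> S4"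
    using s p pinv(1)[OF s] by (simp_all only: act_in_S4)
qed

section \<open>Traces of elementary tensors against permutations\<close>

definition ten :: "(nat \<Rightarrow> nat \<Rightarrow> nat \<Rightarrow> complex) \<Rightarrow> nat list \<Rightarrow> nat list \<Rightarrow> complex" where
  "ten N x y = (\<Prod>m<4. N m (x ! m) (y ! m))"

text \<open>The trace of \<open>N 0\<close> \<otimes> \<open>N 1\<close> \<otimes>
  \<open>N 2\<close> \<otimes> \<open>N 3\<close> composed with a permutation operator. It factors
  over the cycles of \<open>p\<close>, each cycle giving the trace of the product of the matrices
  met along it.\<close>

definition ptr :: "nat \<Rightarrow> (nat \<Rightarrow> nat \<Rightarrow> nat \<Rightarrow> complex) \<Rightarrow> nat list \<Rightarrow> complex" where
  "ptr d N p = (\<Sum>x\<in>tuples d. ten N x (act x p))"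

definition tr1 :: "nat \<Rightarrow> (nat \<Rightarrow> nat \<Rightarrow> complex) \<Rightarrow> complex" where
  "tr1 d A = (\<Sum>i<d. A i i)"

definition tr2 :: "nat \<Rightarrow> (nat \<Rightarrow> nat \<Rightarrow> complex) \<Rightarrow> (nat \<Rightarrow> nat \<Rightarrow> complex) \<Rightarrow> complex" where
  "tr2 d A B = (\<Sum>i<d. \<Sum>j<d. A i j * B j i)"

definition tr3 :: "nat \<Rightarrow> (nat \<Rightarrow> nat \<Rightarrow> complex) \<Rightarrow> (nat \<Rightarrow> nat \<Rightarrow> complex) \<Rightarrow>
    (nat \<Rightarrow> nat \<Rightarrow> complex) \<Rightarrow> complex" where
  "tr3 d A B C = (\<Sum>i<d. \<Sum>j<d. \<Sum>k<d. A i j * B j k * C k i)"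

definition tr4 :: "nat \<Rightarrow> (nat \<Rightarrow> nat \<Rightarrow> complex) \<Rightarrow> (nat \<Rightarrow> nat \<Rightarrow> complex) \<Rightarrow>
    (nat \<Rightarrow> nat \<Rightarrow> complex) \<Rightarrow> (nat \<Rightarrow> nat \<Rightarrow> complex) \<Rightarrow> complex" where
  "tr4 d A B C D = (\<Sum>i<d. \<Sum>j<d. \<Sum>k<d. \<Sum>l<d. A i j * B j k * C k l * D l i)"

lemma ten_Cons:
  "ten N [a,b,c,e] [a',b',c',e'] = N 0 a a' * N 1 b b' * N 2 c c' * N 3 e e'"
  by (simp add: ten_def numeral_eq_Suc lessThan_Suc mult_ac)

lemma cyc1111: "tr1 d A * tr1 d B * tr1 d C * tr1 d D =
    (\<Sum>x\<in>tuples d. A (x!0) (x!0) * B (x!1) (x!1) * C (x!2) (x!2) * D (x!3) (x!3))"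
  by (simp add: tr1_def sum_tuples sum_distrib_left[symmetric] sum_distrib_right[symmetric])

lemma cyc211: "tr2 d A B * tr1 d C * tr1 d D =
    (\<Sum>x\<in>tuples d. A (x!0) (x!1) * B (x!1) (x!0) * C (x!2) (x!2) * D (x!3) (x!3))"
  by (simp add: tr1_def tr2_def sum_tuples sum_distrib_left[symmetric] sum_distrib_right[symmetric])

lemma cyc22: "tr2 d A B * tr2 d C D =
    (\<Sum>x\<in>tuples d. (A (x!0) (x!1) * B (x!1) (x!0)) * (C (x!2) (x!3) * D (x!3) (x!2)))"
  by (simp add: tr1_def tr2_def sum_tuples sum_distrib_left[symmetric] sum_distrib_right[symmetric])

lemma cyc31: "tr3 d A B C * tr1 d D =
    (\<Sum>x\<in>tuples d. A (x!0) (x!1) * B (x!1) (x!2) * C (x!2) (x!0) * D (x!3) (x!3))"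
  by (simp add: tr1_def tr3_def sum_tuples sum_distrib_left[symmetric] sum_distrib_right[symmetric])

lemma cyc4: "tr4 d A B C D =
    (\<Sum>x\<in>tuples d. A (x!0) (x!1) * B (x!1) (x!2) * C (x!2) (x!3) * D (x!3) (x!0))"
  by (simp add: tr4_def sum_tuples sum_distrib_left sum_distrib_right mult.assoc)

lemma ptr_reindex: "s \<in> S4 \<Longrightarrow> ptr d N p = (\<Sum>x\<in>tuples d. ten N (act x s) (act (act x s) p))"
  unfolding ptr_def by (rule sum_tuples_act)

text \<open>In each case the list passed to \<open>ptr_reindex\<close> relabels the summation tuple
  so that the cycles occupy consecutive positions, as in the \<open>cyc\<close> lemmas. A cyclic
  trace may start anywhere; the starting points are chosen so that for \<open>N 0 = N 1 = B\<close>
  and \<open>N 2 = N 3 = A\<close> every longer cycle reads B B A, A A B, B B A A or B A B A, the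
  words treated in \<open>inverse_pair_traces\<close>.\<close>

lemma ptr_cycles:
  "ptr d N [0,1,2,3] = tr1 d (N 0) * tr1 d (N 1) * tr1 d (N 2) * tr1 d (N 3)"
  "ptr d N [0,1,3,2] = tr2 d (N 2) (N 3) * tr1 d (N 0) * tr1 d (N 1)"
  "ptr d N [0,2,1,3] = tr2 d (N 1) (N 2) * tr1 d (N 0) * tr1 d (N 3)"
  "ptr d N [0,3,2,1] = tr2 d (N 1) (N 3) * tr1 d (N 0) * tr1 d (N 2)"
  "ptr d N [1,0,2,3] = tr2 d (N 0) (N 1) * tr1 d (N 2) * tr1 d (N 3)"
  "ptr d N [2,1,0,3] = tr2 d (N 0) (N 2) * tr1 d (N 1) * tr1 d (N 3)"
  "ptr d N [3,1,2,0] = tr2 d (N 0) (N 3) * tr1 d (N 1) * tr1 d (N 2)"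
  "ptr d N [0,2,3,1] = tr3 d (N 2) (N 3) (N 1) * tr1 d (N 0)"
  "ptr d N [0,3,1,2] = tr3 d (N 3) (N 2) (N 1) * tr1 d (N 0)"
  "ptr d N [1,2,0,3] = tr3 d (N 0) (N 1) (N 2) * tr1 d (N 3)"
  "ptr d N [1,3,2,0] = tr3 d (N 0) (N 1) (N 3) * tr1 d (N 2)"
  "ptr d N [2,0,1,3] = tr3 d (N 1) (N 0) (N 2) * tr1 d (N 3)"
  "ptr d N [2,1,3,0] = tr3 d (N 2) (N 3) (N 0) * tr1 d (N 1)"
  "ptr d N [3,0,2,1] = tr3 d (N 1) (N 0) (N 3) * tr1 d (N 2)"
  "ptr d N [3,1,0,2] = tr3 d (N 3) (N 2) (N 0) * tr1 d (N 1)"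
  "ptr d N [1,0,3,2] = tr2 d (N 0) (N 1) * tr2 d (N 2) (N 3)"
  "ptr d N [2,3,0,1] = tr2 d (N 0) (N 2) * tr2 d (N 1) (N 3)"
  "ptr d N [3,2,1,0] = tr2 d (N 0) (N 3) * tr2 d (N 1) (N 2)"
  "ptr d N [1,2,3,0] = tr4 d (N 0) (N 1) (N 2) (N 3)"
  "ptr d N [1,3,0,2] = tr4 d (N 0) (N 1) (N 3) (N 2)"
  "ptr d N [2,0,3,1] = tr4 d (N 1) (N 0) (N 2) (N 3)"
  "ptr d N [2,3,1,0] = tr4 d (N 0) (N 2) (N 1) (N 3)"
  "ptr d N [3,0,1,2] = tr4 d (N 1) (N 0) (N 3) (N 2)"
  "ptr d N [3,2,0,1] = tr4 d (N 0) (N 3) (N 1) (N 2)"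
  subgoal by (subst cyc1111, subst ptr_reindex[of "[0,1,2,3]"]) (simp_all add: S4_explicit ten_Cons mult_ac)
  subgoal by (subst cyc211, subst ptr_reindex[of "[2,3,0,1]"]) (simp_all add: S4_explicit ten_Cons mult_ac)
  subgoal by (subst cyc211, subst ptr_reindex[of "[2,0,1,3]"]) (simp_all add: S4_explicit ten_Cons mult_ac)
  subgoal by (subst cyc211, subst ptr_reindex[of "[2,0,3,1]"]) (simp_all add: S4_explicit ten_Cons mult_ac)
  subgoal by (subst cyc211, subst ptr_reindex[of "[0,1,2,3]"]) (simp_all add: S4_explicit ten_Cons mult_ac)
  subgoal by (subst cyc211, subst ptr_reindex[of "[0,2,1,3]"]) (simp_all add: S4_explicit ten_Cons mult_ac)
  subgoal by (subst cyc211, subst ptr_reindex[of "[0,2,3,1]"]) (simp_all add: S4_explicit ten_Cons mult_ac)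
  subgoal by (subst cyc31, subst ptr_reindex[of "[3,2,0,1]"]) (simp_all add: S4_explicit ten_Cons mult_ac)
  subgoal by (subst cyc31, subst ptr_reindex[of "[3,2,1,0]"]) (simp_all add: S4_explicit ten_Cons mult_ac)
  subgoal by (subst cyc31, subst ptr_reindex[of "[0,1,2,3]"]) (simp_all add: S4_explicit ten_Cons mult_ac)
  subgoal by (subst cyc31, subst ptr_reindex[of "[0,1,3,2]"]) (simp_all add: S4_explicit ten_Cons mult_ac)
  subgoal by (subst cyc31, subst ptr_reindex[of "[1,0,2,3]"]) (simp_all add: S4_explicit ten_Cons mult_ac)
  subgoal by (subst cyc31, subst ptr_reindex[of "[2,3,0,1]"]) (simp_all add: S4_explicit ten_Cons mult_ac)
  subgoal by (subst cyc31, subst ptr_reindex[of "[1,0,3,2]"]) (simp_all add: S4_explicit ten_Cons mult_ac)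
  subgoal by (subst cyc31, subst ptr_reindex[of "[2,3,1,0]"]) (simp_all add: S4_explicit ten_Cons mult_ac)
  subgoal by (subst cyc22, subst ptr_reindex[of "[0,1,2,3]"]) (simp_all add: S4_explicit ten_Cons mult_ac)
  subgoal by (subst cyc22, subst ptr_reindex[of "[0,2,1,3]"]) (simp_all add: S4_explicit ten_Cons mult_ac)
  subgoal by (subst cyc22, subst ptr_reindex[of "[0,2,3,1]"]) (simp_all add: S4_explicit ten_Cons mult_ac)
  subgoal by (subst cyc4, subst ptr_reindex[of "[0,1,2,3]"]) (simp_all add: S4_explicit ten_Cons mult_ac)
  subgoal by (subst cyc4, subst ptr_reindex[of "[0,1,3,2]"]) (simp_all add: S4_explicit ten_Cons mult_ac)
  subgoal by (subst cyc4, subst ptr_reindex[of "[1,0,2,3]"]) (simp_all add: S4_explicit ten_Cons mult_ac)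
  subgoal by (subst cyc4, subst ptr_reindex[of "[0,2,1,3]"]) (simp_all add: S4_explicit ten_Cons mult_ac)
  subgoal by (subst cyc4, subst ptr_reindex[of "[1,0,3,2]"]) (simp_all add: S4_explicit ten_Cons mult_ac)
  subgoal by (subst cyc4, subst ptr_reindex[of "[0,2,3,1]"]) (simp_all add: S4_explicit ten_Cons mult_ac)
  done

section \<open>Class functions and the Weingarten function\<close>

lemma nth_4: "[a,b,c,e] ! 0 = a" "[a,b,c,e] ! 1 = b" "[a,b,c,e] ! 2 = c" "[a,b,c,e] ! 3 = e"
  by simp_all

lemma ball_S4: "(\<forall>p\<in>S4. Q p) \<longleftrightarrow>
     Q [0,1,2,3] \<and> Q [0,1,3,2] \<and> Q [0,2,1,3] \<and> Q [0,2,3,1] \<and> Q [0,3,1,2] \<and> Q [0,3,2,1] \<and>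
     Q [1,0,2,3] \<and> Q [1,0,3,2] \<and> Q [1,2,0,3] \<and> Q [1,2,3,0] \<and> Q [1,3,0,2] \<and> Q [1,3,2,0] \<and>
     Q [2,0,1,3] \<and> Q [2,0,3,1] \<and> Q [2,1,0,3] \<and> Q [2,1,3,0] \<and> Q [2,3,0,1] \<and> Q [2,3,1,0] \<and>
     Q [3,0,1,2] \<and> Q [3,0,2,1] \<and> Q [3,1,0,2] \<and> Q [3,1,2,0] \<and> Q [3,2,0,1] \<and> Q [3,2,1,0]"
  unfolding S4_explicit by simp

text \<open>Values on the identity, transpositions, double transpositions, 3-cycles and 4-cycles.\<close>

definition class_fun :: "'a \<Rightarrow> 'a \<Rightarrow> 'a \<Rightarrow> 'a \<Rightarrow> 'a \<Rightarrow> nat list \<Rightarrow> 'a" where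
  "class_fun cI cT cD c3 c4 p =
     (if p = [0,1,2,3] then cI
      else if p \<in> {[0,1,3,2], [0,2,1,3], [0,3,2,1], [1,0,2,3], [2,1,0,3], [3,1,2,0]} then cT
      else if p \<in> {[1,0,3,2], [2,3,0,1], [3,2,1,0]} then cD
      else if p \<in> {[1,2,3,0], [1,3,0,2], [2,0,3,1], [2,3,1,0], [3,0,1,2], [3,2,0,1]} then c4
      else c3)"

lemma class_fun_simps:
  "class_fun cI cT cD c3 c4 [0,1,2,3] = cI"
  "class_fun cI cT cD c3 c4 [0,1,3,2] = cT"
  "class_fun cI cT cD c3 c4 [0,2,1,3] = cT"
  "class_fun cI cT cD c3 c4 [0,2,3,1] = c3"
  "class_fun cI cT cD c3 c4 [0,3,1,2] = c3"
  "class_fun cI cT cD c3 c4 [0,3,2,1] = cT"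
  "class_fun cI cT cD c3 c4 [1,0,2,3] = cT"
  "class_fun cI cT cD c3 c4 [1,0,3,2] = cD"
  "class_fun cI cT cD c3 c4 [1,2,0,3] = c3"
  "class_fun cI cT cD c3 c4 [1,2,3,0] = c4"
  "class_fun cI cT cD c3 c4 [1,3,0,2] = c4"
  "class_fun cI cT cD c3 c4 [1,3,2,0] = c3"
  "class_fun cI cT cD c3 c4 [2,0,1,3] = c3"
  "class_fun cI cT cD c3 c4 [2,0,3,1] = c4"
  "class_fun cI cT cD c3 c4 [2,1,0,3] = cT"
  "class_fun cI cT cD c3 c4 [2,1,3,0] = c3"
  "class_fun cI cT cD c3 c4 [2,3,0,1] = cD"
  "class_fun cI cT cD c3 c4 [2,3,1,0] = c4"
  "class_fun cI cT cD c3 c4 [3,0,1,2] = c4"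
  "class_fun cI cT cD c3 c4 [3,0,2,1] = c3"
  "class_fun cI cT cD c3 c4 [3,1,0,2] = c3"
  "class_fun cI cT cD c3 c4 [3,1,2,0] = cT"
  "class_fun cI cT cD c3 c4 [3,2,0,1] = c4"
  "class_fun cI cT cD c3 c4 [3,2,1,0] = cD"
  by (simp_all add: class_fun_def)

lemma pinv_simps:
  "pinv [0,1,2,3] = [0,1,2,3]"
  "pinv [0,1,3,2] = [0,1,3,2]"
  "pinv [0,2,1,3] = [0,2,1,3]"
  "pinv [0,2,3,1] = [0,3,1,2]"
  "pinv [0,3,1,2] = [0,2,3,1]"
  "pinv [0,3,2,1] = [0,3,2,1]"
  "pinv [1,0,2,3] = [1,0,2,3]"
  "pinv [1,0,3,2] = [1,0,3,2]"
  "pinv [1,2,0,3] = [2,0,1,3]"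
  "pinv [1,2,3,0] = [3,0,1,2]"
  "pinv [1,3,0,2] = [2,0,3,1]"
  "pinv [1,3,2,0] = [3,0,2,1]"
  "pinv [2,0,1,3] = [1,2,0,3]"
  "pinv [2,0,3,1] = [1,3,0,2]"
  "pinv [2,1,0,3] = [2,1,0,3]"
  "pinv [2,1,3,0] = [3,1,0,2]"
  "pinv [2,3,0,1] = [2,3,0,1]"
  "pinv [2,3,1,0] = [3,2,0,1]"
  "pinv [3,0,1,2] = [1,2,3,0]"
  "pinv [3,0,2,1] = [1,3,2,0]"
  "pinv [3,1,0,2] = [2,1,3,0]"
  "pinv [3,1,2,0] = [3,1,2,0]"
  "pinv [3,2,0,1] = [2,3,1,0]"
  "pinv [3,2,1,0] = [3,2,1,0]"
  by (simp_all add: pinv_def)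

text \<open>Class functions form the centre of the group algebra, so their convolution is again one.
  The integer coefficients are the structure constants: they count the factorisations of a fixed
  \<open>u\<close> into elements of two given classes. Inverting \<Gamma> thereby shrinks from 24
  unknowns to 5.\<close>

lemma class_fun_conv:
  fixes cI cT cD c3 c4 eI eT eD e3 e4 :: "'a :: comm_ring_1"
  assumes "u \<in> S4"
  shows "(\<Sum>s\<in>S4. class_fun cI cT cD c3 c4 s * class_fun eI eT eD e3 e4 (act (pinv s) u)) =
    class_fun
     (cI * eI + 6 * cT * eT + 3 * cD * eD + 8 * c3 * e3 + 6 * c4 * e4)
     (cI * eT + cT * eI + cT * eD + 4 * cT * e3 + cD * eT + 2 * cD * e4 + 4 * c3 * eT + 4 * c3 * e4 + 2 * c4 * eD + 4 * c4 * e3)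
     (cI * eD + 2 * cT * eT + 4 * cT * e4 + cD * eI + 2 * cD * eD + 8 * c3 * e3 + 4 * c4 * eT + 2 * c4 * e4)
     (cI * e3 + 3 * cT * eT + 3 * cT * e4 + 3 * cD * e3 + c3 * eI + 3 * c3 * eD + 4 * c3 * e3 + 3 * c4 * eT + 3 * c4 * e4)
     (cI * e4 + 2 * cT * eD + 4 * cT * e3 + 2 * cD * eT + cD * e4 + 4 * c3 * eT + 4 * c3 * e4 + c4 * eI + c4 * eD + 4 * c4 * e3) u"
proof -
  have "\<forall>u\<in>S4. (\<Sum>s\<in>S4. class_fun cI cT cD c3 c4 s * class_fun eI eT eD e3 e4 (act (pinv s) u)) =
    class_fun
     (cI * eI + 6 * cT * eT + 3 * cD * eD + 8 * c3 * e3 + 6 * c4 * e4)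
     (cI * eT + cT * eI + cT * eD + 4 * cT * e3 + cD * eT + 2 * cD * e4 + 4 * c3 * eT + 4 * c3 * e4 + 2 * c4 * eD + 4 * c4 * e3)
     (cI * eD + 2 * cT * eT + 4 * cT * e4 + cD * eI + 2 * cD * eD + 8 * c3 * e3 + 4 * c4 * eT + 2 * c4 * e4)
     (cI * e3 + 3 * cT * eT + 3 * cT * e4 + 3 * cD * e3 + c3 * eI + 3 * c3 * eD + 4 * c3 * e3 + 3 * c4 * eT + 3 * c4 * e4)
     (cI * e4 + 2 * cT * eD + 4 * cT * e3 + 2 * cD * eT + cD * e4 + 4 * c3 * eT + 4 * c3 * e4 + c4 * eI + c4 * eD + 4 * c4 * e3) u"
    unfolding ball_S4 sum_S4
    by (simp add: nth_4 pinv_simps class_fun_simps algebra_simps del: One_nat_def)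
  then show ?thesis using assms by blast
qed

definition delta :: "nat \<Rightarrow> nat \<Rightarrow> complex" where
  "delta i j = of_bool (i = j)"

definition mprod :: "nat \<Rightarrow> (nat \<Rightarrow> nat \<Rightarrow> complex) \<Rightarrow> (nat \<Rightarrow> nat \<Rightarrow> complex) \<Rightarrow> nat \<Rightarrow> nat \<Rightarrow> complex" where
  "mprod d A B i j = (\<Sum>k<d. A i k * B k j)"

definition inverse_pair :: "nat \<Rightarrow> (nat \<Rightarrow> nat \<Rightarrow> complex) \<Rightarrow> (nat \<Rightarrow> nat \<Rightarrow> complex) \<Rightarrow> bool" where
  "inverse_pair d A B \<longleftrightarrow>
     (\<forall>i<d. \<forall>j<d. mprod d A B i j = delta i j \<and> mprod d B A i j = delta i j)"

lemma sum_delta_left: "i < d \<Longrightarrow> (\<Sum>k<d. delta i k * f k) = f i"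
  by (simp add: delta_def of_bool_def if_distrib if_distribR sum.delta cong: if_cong)

lemma sum_delta_right: "i < d \<Longrightarrow> (\<Sum>k<d. f k * delta k i) = f i"
  by (simp add: delta_def of_bool_def if_distrib if_distribR sum.delta cong: if_cong)

lemma sum_delta_right': "i < d \<Longrightarrow> (\<Sum>k<d. f k * delta i k) = f i"
  by (simp add: delta_def of_bool_def if_distrib if_distribR sum.delta cong: if_cong)

lemma inverse_pair_sum:
  assumes "inverse_pair d A B" "i < d" "j < d"
  shows "(\<Sum>k<d. A i k * B k j) = delta i j" "(\<Sum>k<d. B i k * A k j) = delta i j"
  using assms by (auto simp: inverse_pair_def mprod_def)

lemma inverse_pair_traces:
  assumes "inverse_pair d A B"
  shows "tr2 d B A = of_nat d" "tr2 d A B = of_nat d"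
    "tr3 d B B A = tr1 d B" "tr3 d A A B = tr1 d A"
    "tr4 d B B A A = of_nat d" "tr4 d B A B A = of_nat d"
proof -
  note sums = inverse_pair_sum[OF assms]
  show "tr2 d B A = of_nat d" "tr2 d A B = of_nat d"
    by (simp_all add: tr2_def sums delta_def)
  show "tr3 d B B A = tr1 d B" "tr3 d A A B = tr1 d A"
    by (simp_all add: tr3_def tr1_def sums mult.assoc sum_delta_right flip: sum_distrib_left)
  have "tr4 d B B A A = (\<Sum>i<d. \<Sum>j<d. B i j * (\<Sum>k<d. B j k * (\<Sum>l<d. A k l * A l i)))"
    by (simp add: tr4_def mult.assoc sum_distrib_left)
  also have "\<dots> = (\<Sum>i<d. \<Sum>j<d. B i j * (\<Sum>l<d. (\<Sum>k<d. B j k * A k l) * A l i))"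
    by (simp add: sum_distrib_left sum_distrib_right mult.assoc)
       (intro sum.cong refl sum.swap)
  also have "\<dots> = (\<Sum>i<d. \<Sum>j<d. B i j * A j i)"
    by (simp add: sums sum_delta_left)
  finally show "tr4 d B B A A = of_nat d" by (simp add: sums delta_def)
  have "tr4 d B A B A = (\<Sum>i<d. \<Sum>j<d. B i j * (\<Sum>k<d. A j k * (\<Sum>l<d. B k l * A l i)))"
    by (simp add: tr4_def mult.assoc sum_distrib_left)
  also have "\<dots> = (\<Sum>i<d. \<Sum>j<d. B i j * A j i)"
    by (simp add: sums sum_delta_right)
  finally show "tr4 d B A B A = of_nat d" by (simp add: sums delta_def)
qed

text \<open>At \<open>act (pinv p) q\<close> this is the Hilbert--Schmidt inner product of the
  permutation operators of \<open>p\<close> and \<open>q\<close>, hence an entry of their Gram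
  matrix.\<close>

definition gram :: "nat \<Rightarrow> nat list \<Rightarrow> real" where
  "gram d = class_fun (real d ^ 4) (real d ^ 3) ((real d)\<^sup>2) ((real d)\<^sup>2) (real d)"

lemma ptr_delta: "p \<in> S4 \<Longrightarrow> ptr d (\<lambda>_. delta) p = of_real (gram d p)"
proof -
  have i: "inverse_pair d delta delta"
    by (auto simp: inverse_pair_def mprod_def sum_delta_left)
  have t: "tr1 d delta = of_nat d" by (simp add: tr1_def delta_def)
  have "\<forall>p\<in>S4. ptr d (\<lambda>_. delta) p = of_real (gram d p)"
    unfolding ball_S4 gram_def class_fun_simps
    by (simp add: ptr_cycles inverse_pair_traces[OF i] t power2_eq_square power3_eq_cube
          power4_eq_xxxx del: One_nat_def)
  then show "p \<in> S4 \<Longrightarrow> ptr d (\<lambda>_. delta) p = of_real (gram d p)" by blast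
qed

text \<open>\<open>traceless_val d x p\<close> is the trace of \<open>A\<^sup>* \<otimes> A\<^sup>* \<otimes> A \<otimes> A\<close> times the permutation \<open>p\<close>
  of the tensor factors when \<open>A\<close> is unitary with \<open>tr A = 0\<close> and \<open>\<bar>tr A\<^sup>2\<bar>\<^sup>2 = x\<close>.\<close>

definition traceless_val :: "nat \<Rightarrow> real \<Rightarrow> nat list \<Rightarrow> real" where
  "traceless_val d x p =
     (if p = [1,0,3,2] then x else class_fun 0 0 ((real d)\<^sup>2) 0 (real d) p)"

lemma traceless_val_simps:
  "traceless_val d x [0,1,2,3] = 0"
  "traceless_val d x [0,1,3,2] = 0"
  "traceless_val d x [0,2,1,3] = 0"
  "traceless_val d x [0,2,3,1] = 0"
  "traceless_val d x [0,3,1,2] = 0"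
  "traceless_val d x [0,3,2,1] = 0"
  "traceless_val d x [1,0,2,3] = 0"
  "traceless_val d x [1,0,3,2] = x"
  "traceless_val d x [1,2,0,3] = 0"
  "traceless_val d x [1,2,3,0] = real d"
  "traceless_val d x [1,3,0,2] = real d"
  "traceless_val d x [1,3,2,0] = 0"
  "traceless_val d x [2,0,1,3] = 0"
  "traceless_val d x [2,0,3,1] = real d"
  "traceless_val d x [2,1,0,3] = 0"
  "traceless_val d x [2,1,3,0] = 0"
  "traceless_val d x [2,3,0,1] = (real d)\<^sup>2"
  "traceless_val d x [2,3,1,0] = real d"
  "traceless_val d x [3,0,1,2] = real d"
  "traceless_val d x [3,0,2,1] = 0"
  "traceless_val d x [3,1,0,2] = 0"
  "traceless_val d x [3,1,2,0] = 0"
  "traceless_val d x [3,2,0,1] = real d"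
  "traceless_val d x [3,2,1,0] = (real d)\<^sup>2"
  by (simp_all add: traceless_val_def class_fun_def)

text \<open>A fixed point of \<open>p\<close> contributes a factor tr A or tr B, which is 0. Only
  the three double transpositions and the six 4-cycles remain; among them \<open>[1,0,3,2]\<close>
  alone pairs equal matrices, and in the others A and B cancel down to a power of
  \<open>d\<close>.\<close>

lemma ptr_traceless:
  assumes i: "inverse_pair d A B" and t: "tr1 d A = 0" "tr1 d B = 0"
    and x: "tr2 d B B * tr2 d A A = of_real x" and p: "p \<in> S4"
  shows "ptr d (\<lambda>m. if m < 2 then B else A) p = of_real (traceless_val d x p)"
proof -
  have "\<forall>p\<in>S4. ptr d (\<lambda>m. if m < 2 then B else A) p = of_real (traceless_val d x p)"
    unfolding ball_S4 traceless_val_simps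
    by (simp add: ptr_cycles inverse_pair_traces[OF i] t x power2_eq_square del: One_nat_def)
  then show ?thesis using p by blast
qed

text \<open>\<open>W\<close> is a Weingarten function: \<open>\<Sum>\<^sub>s W(s) P\<^sub>s\<close> inverts \<open>\<Sum>\<^sub>p d\<^bsup>#cycles(p)\<^esup> P\<^sub>p\<close>,
  as operators on \<open>(\<complex>\<^sup>d)\<^bsup>\<otimes>4\<^esup>\<close>.\<close>

definition gram_inverse :: "nat \<Rightarrow> (nat list \<Rightarrow> real) \<Rightarrow> bool" where
  "gram_inverse d W \<longleftrightarrow> (\<forall>F :: nat list \<Rightarrow> complex. \<forall>a\<in>tuples d.
     (\<Sum>s\<in>S4. \<Sum>p\<in>S4. of_real (W s * gram d p) * F (act (act a s) p)) = F a)"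

text \<open>Substituting u = s p turns the double sum into a convolution. Proving
  \<open>gram_inverse\<close> then splits into computing the class function \<open>h\<close> and
  checking that \<open>h\<close> acts as the identity on functions of tuples.\<close>

lemma gram_sum:
  fixes F :: "nat list \<Rightarrow> complex"
  assumes "\<And>u. u \<in> S4 \<Longrightarrow> (\<Sum>s\<in>S4. W s * gram d (act (pinv s) u)) = h u"
  shows "(\<Sum>s\<in>S4. \<Sum>p\<in>S4. of_real (W s * gram d p) * F (act (act a s) p)) =
    (\<Sum>u\<in>S4. of_real (h u) * F (act a u))"
proof -
  have "(\<Sum>p\<in>S4. of_real (W s * gram d p) * F (act (act a s) p)) =
        (\<Sum>u\<in>S4. of_real (W s * gram d (act (pinv s) u)) * F (act a u))" if s: "s \<in> S4" for s
    unfolding sum_S4_act[OF s, of "\<lambda>u. of_real (W s * gram d (act (pinv s) u)) * F (act a u)"]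
  proof (intro sum.cong refl)
    fix p assume p: "p \<in> S4"
    have "act (pinv s) (act s p) = p"
      using pinv[OF s] s p by (simp only: act_assoc_S4[symmetric] id_act)
    then show "of_real (W s * gram d p) * F (act (act a s) p) =
        of_real (W s * gram d (act (pinv s) (act s p))) * F (act a (act s p))"
      using s p by (simp add: act_assoc_S4)
  qed
  then have "(\<Sum>s\<in>S4. \<Sum>p\<in>S4. of_real (W s * gram d p) * F (act (act a s) p)) =
      (\<Sum>s\<in>S4. \<Sum>u\<in>S4. of_real (W s * gram d (act (pinv s) u)) * F (act a u))"
    by (rule sum.cong[OF refl])
  also have "\<dots> = (\<Sum>u\<in>S4. of_real (\<Sum>s\<in>S4. W s * gram d (act (pinv s) u)) * F (act a u))"
    by (subst sum.swap) (simp add: sum_distrib_right)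
  also have "\<dots> = (\<Sum>u\<in>S4. of_real (h u) * F (act a u))"
    using assms by (intro sum.cong) auto
  finally show ?thesis .
qed

lemma class_fun_cong:
  "cI = eI \<Longrightarrow> cT = eT \<Longrightarrow> cD = eD \<Longrightarrow> c3 = e3 \<Longrightarrow> c4 = e4 \<Longrightarrow>
   class_fun cI cT cD c3 c4 p = class_fun eI eT eD e3 e4 p"
  by simp

text \<open>These are the values of the unitary Weingarten function of degree four, brought to the
  common denominator \<open>n\<close>. The bound on \<open>d\<close> keeps \<open>n\<close> nonzero,
  and the convolution is then the unit of the group algebra itself.\<close>

lemma gram_inverse_ge_4:
  assumes "d \<ge> 4"
  defines "n \<equiv> (real d)\<^sup>2 * ((real d)\<^sup>2 - 1) * ((real d)\<^sup>2 - 4) * ((real d)\<^sup>2 - 9)"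
  shows "gram_inverse d (class_fun ((real d ^ 4 - 8 * (real d)\<^sup>2 + 6) / n) (- real d * ((real d)\<^sup>2 - 4) / n)
    (((real d)\<^sup>2 + 6) / n) ((2 * (real d)\<^sup>2 - 3) / n) (- 5 * real d / n))" (is "gram_inverse d ?W")
proof -
  have "(real d)\<^sup>2 \<ge> 4\<^sup>2" using assms(1) by (intro power_mono) auto
  then have n: "n \<noteq> 0" unfolding n_def using assms(1) by auto
  define D where "D = real d"
  \<comment> \<open>With 1/n as a symbol, the five class equations are polynomial in
    \<open>D\<close> and linear in \<open>m\<close>. The equation of the identity class reduces to
    \<open>n * m = 1\<close>; the other four have value 0.\<close>
  define m where "m = inverse n"
  have nm: "n * m = 1" using n by (simp add: m_def)
  have "(\<Sum>s\<in>S4. ?W s * gram d (act (pinv s) u)) = class_fun 1 0 0 0 0 u" if "u \<in> S4" for u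
    unfolding gram_def class_fun_conv[OF that] D_def[symmetric] divide_inverse m_def[symmetric]
    by (intro class_fun_cong; (rule trans[OF _ nm])?, simp add: n_def D_def[symmetric],
        simp only: power2_eq_square power3_eq_cube power4_eq_xxxx, algebra)
  note h = this
  have "(\<Sum>u\<in>S4. of_real (class_fun 1 0 0 0 0 u) * F (act a u)) = F a"
    if "a \<in> tuples d" for F :: "nat list \<Rightarrow> complex" and a
  proof -
    have "length a = 4" using that by (simp add: tuples_def)
    then show ?thesis unfolding sum_S4 class_fun_simps by (simp only: act_id) simp
  qed
  then show ?thesis unfolding gram_inverse_def by (simp only: gram_sum[OF h]) blast
qed

text \<open>For \<open>d < 4\<close> the Gram matrix is singular and the values below form its pseudo-inverse
  among class functions; the product with \<open>gram d\<close> differs from the unit by an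
  antisymmetriser, which vanishes because some of the four indices coincide.\<close>

lemma gram_inverse_3:
  "gram_inverse 3 (class_fun (61/2880) (-7/1728) (-11/2880) (-1/960) (37/8640))" (is "gram_inverse _ ?W")
proof -
  have h: "(\<Sum>s\<in>S4. ?W s * gram 3 (act (pinv s) u)) = class_fun (23/24) (1/24) (-1/24) (-1/24) (1/24) u"
    if "u \<in> S4" for u
    unfolding gram_def class_fun_conv[OF that] by simp
  have "(\<Sum>u\<in>S4. of_real (class_fun (23/24) (1/24) (-1/24) (-1/24) (1/24) u) * F (act a u)) = F a"
    if "a \<in> tuples 3" for F :: "nat list \<Rightarrow> complex" and a
  proof -
    have "length a = 4" using that by (simp add: tuples_def)
    then obtain i j k l where a: "a = [i,j,k,l]"
      by (auto simp: length_Suc_conv numeral_eq_Suc)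
    have "i < 3" "j < 3" "k < 3" "l < 3" using that a by (auto simp: tuples_def)
    \<comment> \<open>Pigeonhole. Swapping two positions with equal entries fixes the tuple and
      reverses the sign, so the terms of the signed sum cancel in pairs.\<close>
    then have "i = j \<or> i = k \<or> i = l \<or> j = k \<or> j = l \<or> k = l" by linarith
    then show ?thesis unfolding a sum_S4 class_fun_simps
      by (elim disjE) (simp_all add: nth_4 algebra_simps del: One_nat_def)
  qed
  then show ?thesis unfolding gram_inverse_def by (simp only: gram_sum[OF h]) blast
qed

lemma gram_inverse_2:
  "gram_inverse 2 (class_fun (43/1440) (1/180) (13/1440) (-19/2880) (-7/1440))" (is "gram_inverse _ ?W")
proof -
  \<comment> \<open>The unit minus the central projections for the shapes (1,1,1,1) and (2,1,1), the
    diagrams with more than two rows. Their degrees are 1 and 3, whence 24 - 1 - 9 = 14 at the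
    identity.\<close>
  have h: "(\<Sum>s\<in>S4. ?W s * gram 2 (act (pinv s) u)) = class_fun (14/24) (4/24) (2/24) (-1/24) (-2/24) u"
    if "u \<in> S4" for u
    unfolding gram_def class_fun_conv[OF that] by simp
  have "(\<Sum>u\<in>S4. of_real (class_fun (14/24) (4/24) (2/24) (-1/24) (-2/24) u) * F (act a u)) = F a"
    if "a \<in> tuples 2" for F :: "nat list \<Rightarrow> complex" and a
  proof -
    have "length a = 4" using that by (simp add: tuples_def)
    then obtain i j k l where a: "a = [i,j,k,l]"
      by (auto simp: length_Suc_conv numeral_eq_Suc)
    have "i < 2" "j < 2" "k < 2" "l < 2" using that a by (auto simp: tuples_def)
    \<comment> \<open>Four entries with two possible values: either three coincide or they form two
      equal pairs.\<close>
    then have "(i = j \<and> j = k) \<or> (i = j \<and> j = l) \<or> (i = k \<and> k = l) \<or> (j = k \<and> k = l) \<or>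
        (i = j \<and> k = l) \<or> (i = k \<and> j = l) \<or> (i = l \<and> j = k)" by linarith
    then show ?thesis unfolding a sum_S4 class_fun_simps
      by (elim disjE conjE) (simp_all add: nth_4 algebra_simps del: One_nat_def)
  qed
  then show ?thesis unfolding gram_inverse_def by (simp only: gram_sum[OF h]) blast
qed

section \<open>The commutant of the fourth tensor power\<close>

type_synonym cmat = "nat \<Rightarrow> nat \<Rightarrow> complex"

definition commutes :: "nat \<Rightarrow> (nat list \<Rightarrow> nat list \<Rightarrow> complex) \<Rightarrow> (nat list \<Rightarrow> nat list \<Rightarrow> complex) \<Rightarrow> bool" where
  "commutes d T S \<longleftrightarrow> (\<forall>x\<in>tuples d. \<forall>z\<in>tuples d.
     (\<Sum>y\<in>tuples d. T x y * S y z) = (\<Sum>y\<in>tuples d. S x y * T y z))"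

lemma tuplesE:
  assumes "x \<in> tuples d"
  obtains i j k l where "x = [i,j,k,l]" "i < d" "j < d" "k < d" "l < d"
proof -
  have "length x = 4" using assms by (simp add: tuples_def)
  then obtain i j k l where x: "x = [i,j,k,l]"
    by (auto simp: length_Suc_conv numeral_eq_Suc)
  then show ?thesis using that assms by (simp add: tuples_def)
qed

lemma tuples_Cons [simp]: "[i,j,k,l] \<in> tuples d \<longleftrightarrow> i < d \<and> j < d \<and> k < d \<and> l < d"
  by (auto simp: tuples_def)

lemma tuples_nth: "x \<in> tuples d \<Longrightarrow> m < 4 \<Longrightarrow> x ! m < d"
  using nth_mem[of m x] by (auto simp: tuples_def simp del: nth_mem)

lemma ten_cong:
  assumes "x \<in> tuples d" "y \<in> tuples d"
    and "\<And>m i j. m < 4 \<Longrightarrow> i < d \<Longrightarrow> j < d \<Longrightarrow> M m i j = N m i j"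
  shows "ten M x y = ten N x y"
  unfolding ten_def using assms by (intro prod.cong) (auto simp: tuples_nth)

lemma sum4_prod:
  fixes f g h e :: "nat \<Rightarrow> complex"
  shows "(\<Sum>i<d. \<Sum>j<d. \<Sum>k<d. \<Sum>l<d. f i * g j * h k * e l) = sum f {..<d} * sum g {..<d} * sum h {..<d} * sum e {..<d}"
  by (simp add: sum_distrib_left[symmetric] sum_distrib_right[symmetric])

lemma prod_less_4: "(\<Prod>m<4. g m) = g 0 * g 1 * g 2 * g (3::nat)" for g :: "nat \<Rightarrow> complex"
  by (simp add: numeral_eq_Suc lessThan_Suc mult_ac)

lemma sum_tuples_prod:
  fixes f :: "nat \<Rightarrow> nat \<Rightarrow> complex"
  shows "(\<Sum>x\<in>tuples d. \<Prod>m<4. f m (x ! m)) = (\<Prod>m<4. \<Sum>i<d. f m i)"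
  unfolding prod_less_4 sum_tuples by (simp add: sum4_prod)

lemma ten_mult:
  "(\<Sum>y\<in>tuples d. ten M x y * ten N y z) = ten (\<lambda>m. mprod d (M m) (N m)) x z"
  unfolding ten_def mprod_def prod.distrib[symmetric] by (rule sum_tuples_prod)

lemma commutes_cong:
  assumes "\<And>x y. x \<in> tuples d \<Longrightarrow> y \<in> tuples d \<Longrightarrow> S x y = S' x y"
  shows "commutes d T S \<longleftrightarrow> commutes d T S'"
  unfolding commutes_def by (intro ball_cong refl arg_cong2[where f="(=)"] sum.cong) (simp_all add: assms)

lemma commutes_mult:
  assumes "commutes d T S" "commutes d T S'"
  shows "commutes d T (\<lambda>x z. \<Sum>y\<in>tuples d. S x y * S' y z)"
  unfolding commutes_def
proof (intro ballI)
  fix x z assume xz: "x \<in> tuples d" "z \<in> tuples d"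
  have "(\<Sum>y\<in>tuples d. T x y * (\<Sum>u\<in>tuples d. S y u * S' u z)) =
      (\<Sum>u\<in>tuples d. (\<Sum>y\<in>tuples d. T x y * S y u) * S' u z)"
    by (simp add: sum_distrib_left sum_distrib_right mult.assoc) (rule sum.swap)
  also have "\<dots> = (\<Sum>u\<in>tuples d. (\<Sum>y\<in>tuples d. S x y * T y u) * S' u z)"
    using assms(1) xz by (intro sum.cong) (auto simp: commutes_def)
  also have "\<dots> = (\<Sum>y\<in>tuples d. S x y * (\<Sum>u\<in>tuples d. T y u * S' u z))"
    by (simp add: sum_distrib_left sum_distrib_right mult.assoc) (rule sum.swap)
  also have "\<dots> = (\<Sum>y\<in>tuples d. S x y * (\<Sum>u\<in>tuples d. S' y u * T u z))"
    using assms(2) xz by (intro sum.cong) (auto simp: commutes_def)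
  also have "\<dots> = (\<Sum>u\<in>tuples d. (\<Sum>y\<in>tuples d. S x y * S' y u) * T u z)"
    by (simp add: sum_distrib_left sum_distrib_right mult.assoc) (rule sum.swap)
  finally show "(\<Sum>y\<in>tuples d. T x y * (\<Sum>u\<in>tuples d. S y u * S' u z)) =
      (\<Sum>y\<in>tuples d. (\<Sum>u\<in>tuples d. S x u * S' u y) * T y z)" .
qed

lemma commutes_sum:
  assumes "\<And>i. i \<in> I \<Longrightarrow> commutes d T (S i)"
  shows "commutes d T (\<lambda>x y. \<Sum>i\<in>I. c i * S i x y)"
  unfolding commutes_def
proof (intro ballI)
  fix x z assume xz: "x \<in> tuples d" "z \<in> tuples d"
  have "(\<Sum>y\<in>tuples d. T x y * (\<Sum>i\<in>I. c i * S i y z)) = (\<Sum>i\<in>I. c i * (\<Sum>y\<in>tuples d. T x y * S i y z))"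
    by (simp add: sum_distrib_left mult.left_commute) (rule sum.swap)
  also have "\<dots> = (\<Sum>i\<in>I. c i * (\<Sum>y\<in>tuples d. S i x y * T y z))"
    using assms xz by (intro sum.cong) (auto simp: commutes_def)
  also have "\<dots> = (\<Sum>y\<in>tuples d. (\<Sum>i\<in>I. c i * S i x y) * T y z)"
    by (simp add: sum_distrib_left sum_distrib_right mult.assoc) (rule sum.swap)
  finally show "(\<Sum>y\<in>tuples d. T x y * (\<Sum>i\<in>I. c i * S i y z)) = (\<Sum>y\<in>tuples d. (\<Sum>i\<in>I. c i * S i x y) * T y z)" .
qed

lemma commutes_diff:
  assumes "commutes d T S" "commutes d T S'"
  shows "commutes d T (\<lambda>x y. S x y - S' x y)"
  using assms by (simp add: commutes_def algebra_simps sum_subtractf)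

section \<open>One-site operators and symmetrised tensors\<close>

definition site :: "nat \<Rightarrow> cmat \<Rightarrow> nat list \<Rightarrow> nat list \<Rightarrow> complex" where
  "site m B = ten ((\<lambda>_. delta)(m := B))"

text \<open>The derived (Lie algebra) action of \<open>B\<close> on the fourth tensor power: the
  linear coefficient in \<open>w\<close> of the fourth tensor power of 1 + w B.\<close>

definition site_sum :: "cmat \<Rightarrow> nat list \<Rightarrow> nat list \<Rightarrow> complex" where
  "site_sum B x y = (\<Sum>m<4. site m B x y)"

text \<open>The sum over all injective placements of the factors \<open>As\<close> on the tensor sites \<open>I\<close>,
  the other sites carrying \<open>N\<close>.\<close>

fun symten :: "cmat list \<Rightarrow> nat set \<Rightarrow> (nat \<Rightarrow> cmat) \<Rightarrow> nat list \<Rightarrow> nat list \<Rightarrow> complex" where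
  "symten [] I N = ten N"
| "symten (A # As) I N = (\<lambda>x y. \<Sum>m\<in>I. symten As (I - {m}) (N(m := A)) x y)"

lemma mprod_delta_right: "j < d \<Longrightarrow> mprod d A delta i j = A i j"
  by (simp add: mprod_def sum_delta_right)

lemma mprod_delta_left: "i < d \<Longrightarrow> mprod d delta A i j = A i j"
  by (simp add: mprod_def sum_delta_left)

lemma ten_site:
  assumes "x \<in> tuples d" "z \<in> tuples d"
  shows "(\<Sum>y\<in>tuples d. ten N x y * site m B y z) = ten (N(m := mprod d (N m) B)) x z"
  unfolding site_def ten_mult
  by (rule ten_cong[OF assms]) (auto simp: mprod_delta_right)

lemma symten_site:
  assumes "x \<in> tuples d" "z \<in> tuples d" "m \<notin> I"
  shows "(\<Sum>y\<in>tuples d. symten As I N x y * site m B y z) = symten As I (N(m := mprod d (N m) B)) x z"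
  using assms(3)
proof (induction As arbitrary: I N)
  case Nil
  show ?case unfolding symten.simps by (rule ten_site[OF assms(1,2)])
next
  case (Cons A As)
  have "(\<Sum>y\<in>tuples d. symten (A # As) I N x y * site m B y z) =
      (\<Sum>k\<in>I. \<Sum>y\<in>tuples d. symten As (I - {k}) (N(k := A)) x y * site m B y z)"
    by (simp add: sum_distrib_right) (rule sum.swap)
  also have "\<dots> = (\<Sum>k\<in>I. symten As (I - {k}) ((N(m := mprod d (N m) B))(k := A)) x z)"
  proof (intro sum.cong refl)
    fix k assume "k \<in> I"
    then have k: "k \<noteq> m" "m \<notin> I - {k}" using Cons.prems by auto
    show "(\<Sum>y\<in>tuples d. symten As (I - {k}) (N(k := A)) x y * site m B y z) =
      symten As (I - {k}) ((N(m := mprod d (N m) B))(k := A)) x z"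
      using Cons.IH[OF k(2), of "N(k := A)"] k(1) by (simp only: fun_upd_twist[of m k] fun_upd_other)
  qed
  finally show ?case unfolding symten.simps .
qed

text \<open>Multiplying by \<open>B\<close> on a site of \<open>I\<close> that is still free places
  a new factor, which yields the term with \<open>As @ [B]\<close>. On a site already taken by some
  \<open>As ! i\<close> it only multiplies that factor, which yields the correction terms of
  unchanged length.\<close>

lemma symten_site_sum:
  assumes "x \<in> tuples d" "z \<in> tuples d" "finite I" "\<And>m. m \<in> I \<Longrightarrow> N m = delta"
  shows "(\<Sum>y\<in>tuples d. symten As I N x y * (\<Sum>m\<in>I. site m B y z)) =
    symten (As @ [B]) I N x z + (\<Sum>i<length As. symten (As[i := mprod d (As ! i) B]) I N x z)"
  using assms(3,4)
proof (induction As arbitrary: I N)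
  case Nil
  have "(\<Sum>y\<in>tuples d. ten N x y * (\<Sum>m\<in>I. site m B y z)) = (\<Sum>m\<in>I. \<Sum>y\<in>tuples d. ten N x y * site m B y z)"
    by (simp add: sum_distrib_left) (rule sum.swap)
  also have "\<dots> = (\<Sum>m\<in>I. ten (N(m := B)) x z)"
    unfolding ten_site[OF assms(1,2)]
    by (intro sum.cong refl ten_cong[OF assms(1,2)]) (auto simp: Nil.prems mprod_delta_left)
  finally show ?case by simp
next
  case (Cons A As)
  let ?N = "\<lambda>m. N(m := A)"
  have "(\<Sum>y\<in>tuples d. symten (A # As) I N x y * (\<Sum>m\<in>I. site m B y z)) =
      (\<Sum>k\<in>I. \<Sum>y\<in>tuples d. symten As (I - {k}) (?N k) x y * (\<Sum>m\<in>I. site m B y z))"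
    by (simp add: sum_distrib_right) (rule sum.swap)
  also have "\<dots> = (\<Sum>k\<in>I. symten (As @ [B]) (I - {k}) (?N k) x z
      + (\<Sum>i<length As. symten (As[i := mprod d (As ! i) B]) (I - {k}) (?N k) x z)
      + symten As (I - {k}) (N(k := mprod d A B)) x z)"
  proof (intro sum.cong refl)
    fix k assume k: "k \<in> I"
    have "(\<Sum>y\<in>tuples d. symten As (I - {k}) (?N k) x y * (\<Sum>m\<in>I. site m B y z)) =
        (\<Sum>y\<in>tuples d. symten As (I - {k}) (?N k) x y * (\<Sum>m\<in>I-{k}. site m B y z)) +
        (\<Sum>y\<in>tuples d. symten As (I - {k}) (?N k) x y * site k B y z)"
      unfolding sum.remove[OF Cons.prems(1) k]
      by (simp only: distrib_left sum.distrib add.commute)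
    also have "(\<Sum>y\<in>tuples d. symten As (I - {k}) (?N k) x y * (\<Sum>m\<in>I-{k}. site m B y z)) =
        symten (As @ [B]) (I - {k}) (?N k) x z
      + (\<Sum>i<length As. symten (As[i := mprod d (As ! i) B]) (I - {k}) (?N k) x z)"
      by (rule Cons.IH) (use Cons.prems in auto)
    also have "(\<Sum>y\<in>tuples d. symten As (I - {k}) (?N k) x y * site k B y z) =
        symten As (I - {k}) (N(k := mprod d A B)) x z"
      by (subst symten_site[OF assms(1,2)]) auto
    finally show "(\<Sum>y\<in>tuples d. symten As (I - {k}) (?N k) x y * (\<Sum>m\<in>I. site m B y z)) =
      symten (As @ [B]) (I - {k}) (?N k) x z
      + (\<Sum>i<length As. symten (As[i := mprod d (As ! i) B]) (I - {k}) (?N k) x z)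
      + symten As (I - {k}) (N(k := mprod d A B)) x z" .
  qed
  also have "\<dots> = symten ((A # As) @ [B]) I N x z +
      (\<Sum>i<length (A # As). symten ((A # As)[i := mprod d ((A # As) ! i) B]) I N x z)"
    by (simp only: sum.distrib length_Cons sum.lessThan_Suc_shift nth_Cons_0 nth_Cons_Suc
          list_update_code append_Cons symten.simps sum.swap[of _ I "{..<length As}"] add_ac)
  finally show ?case .
qed

lemma ten_delta: "x \<in> tuples d \<Longrightarrow> y \<in> tuples d \<Longrightarrow> ten (\<lambda>_. delta) x y = of_bool (x = y)"
  by (elim tuplesE) (auto simp: ten_Cons delta_def)

text \<open>\<open>symten_site_sum\<close> is solved for its longest term: \<open>As' @ [B]\<close>
  is a product of operators commuting with \<open>T\<close>, minus symmetrised tensors with as many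
  factors as \<open>As'\<close>. Induction on the number of factors therefore reaches all of them
  from \<open>site_sum\<close> alone.\<close>

lemma commutes_symten:
  assumes "\<And>B. commutes d T (site_sum B)"
  shows "commutes d T (symten As {..<4} (\<lambda>_. delta))"
proof (induction "length As" arbitrary: As)
  case 0
  have "commutes d T (ten (\<lambda>_. delta)) \<longleftrightarrow> commutes d T (\<lambda>x y. of_bool (x = y))"
    by (rule commutes_cong[OF ten_delta])
  moreover have "commutes d T (\<lambda>x y. of_bool (x = y))"
    unfolding commutes_def
  proof (intro ballI)
    fix x z assume xz: "x \<in> tuples d" "z \<in> tuples d"
    have "(\<Sum>y\<in>tuples d. T x y * of_bool (y = z)) = (\<Sum>y\<in>tuples d. if y = z then T x y else 0)"
      by (intro sum.cong) auto
    moreover have "(\<Sum>y\<in>tuples d. of_bool (x = y) * T y z) = (\<Sum>y\<in>tuples d. if x = y then T y z else 0)"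
      by (intro sum.cong) auto
    ultimately show "(\<Sum>y\<in>tuples d. T x y * of_bool (y = z)) = (\<Sum>y\<in>tuples d. of_bool (x = y) * T y z)"
      using xz by simp
  qed
  ultimately show ?case using 0 by simp
next
  case (Suc n)
  then obtain As' B where As: "As = As' @ [B]" "length As' = n"
    by (cases As rule: rev_cases) auto
  let ?S = "\<lambda>As. symten As {..<4} (\<lambda>_. delta)"
  have "commutes d T (\<lambda>x z. (\<Sum>y\<in>tuples d. ?S As' x y * site_sum B y z)
      - (\<Sum>i<n. 1 * ?S (As'[i := mprod d (As' ! i) B]) x z))"
    by (rule commutes_diff[OF commutes_mult[OF Suc(1) assms] commutes_sum[OF Suc(1)]]) (simp_all add: As)
  note c = this
  have "(\<Sum>y\<in>tuples d. ?S As' x y * site_sum B y z)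
      - (\<Sum>i<n. 1 * ?S (As'[i := mprod d (As' ! i) B]) x z) = ?S As x z"
    if "x \<in> tuples d" "z \<in> tuples d" for x z
    using symten_site_sum[OF that, of "{..<4}" "\<lambda>_. delta" As' B] by (simp add: site_sum_def As)
  from commutes_cong[OF this, THEN iffD1, OF _ _ c] show ?case by blast
qed

definition munit :: "nat \<Rightarrow> nat \<Rightarrow> cmat" where
  "munit p q i j = delta i p * delta j q"

text \<open>Placing four factors injectively on four sites amounts to a permutation, so this is the
  symmetrisation of the elementary matrix with row \<open>a\<close> and column \<open>b\<close>. In
  this form the commutation relation can be read off entry by entry.\<close>

lemma symten_munit:
  assumes "a \<in> tuples d" "b \<in> tuples d" "x \<in> tuples d" "y \<in> tuples d"
  shows "symten [munit (a!0) (b!0), munit (a!1) (b!1), munit (a!2) (b!2), munit (a!3) (b!3)]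
      {..<4} (\<lambda>_. delta) x y = (\<Sum>p\<in>S4. of_bool (x = act a p) * of_bool (y = act b p))"
proof -
  have s: "{..<4} = {0,1,2,3::nat}" by auto
  show ?thesis
    using assms by (elim tuplesE) (simp add: s sum_S4 ten_Cons munit_def delta_def nth_4 insert_Diff_if
      of_bool_conj mult_ac add_ac del: One_nat_def)
qed

text \<open>On a one-dimensional space every permutation acts trivially, so any \<open>W\<close>
  whose 24 values add up to 1/24 would do; a multiple of the unit is the simplest.\<close>

lemma gram_inverse_1: "gram_inverse 1 (class_fun (1/24) 0 0 0 0)" (is "gram_inverse _ ?W")
proof -
  have h: "(\<Sum>s\<in>S4. ?W s * gram 1 (act (pinv s) u)) = class_fun (1/24) (1/24) (1/24) (1/24) (1/24) u"
    if "u \<in> S4" for u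
    unfolding gram_def class_fun_conv[OF that] by simp
  have "(\<Sum>u\<in>S4. of_real (class_fun (1/24) (1/24) (1/24) (1/24) (1/24) u) * F (act a u)) = F a"
    if "a \<in> tuples 1" for F :: "nat list \<Rightarrow> complex" and a
  proof -
    have "a = [0,0,0,0]" using that by (elim tuplesE) simp
    then show ?thesis unfolding sum_S4 class_fun_simps by (simp add: nth_4 del: One_nat_def)
  qed
  then show ?thesis unfolding gram_inverse_def by (simp only: gram_sum[OF h]) blast
qed

section \<open>From unitaries to arbitrary matrices\<close>

lemma infinite_unit_circle_shift: "infinite {w::complex. cmod (1 + w) = 1}"
proof -
  have "inj_on (\<lambda>t. cis t - 1) {0..1::real}"
  proof (rule inj_onI)
    fix s t :: real assume st: "s \<in> {0..1}" "t \<in> {0..1}" "cis s - 1 = cis t - 1"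
    then have "Re (cis s - 1) = Re (cis t - 1)" by simp
    then have "cos s = cos t" by simp
    moreover have "0 \<le> s" "s \<le> pi" "0 \<le> t" "t \<le> pi" using st pi_gt3 by auto
    ultimately show "s = t" using cos_inj_pi by blast
  qed
  then have "infinite ((\<lambda>t. cis t - 1) ` {0..1::real})"
    by (simp add: finite_image_iff infinite_Icc)
  moreover have "(\<lambda>t. cis t - 1) ` {0..1::real} \<subseteq> {w::complex. cmod (1 + w) = 1}" by auto
  ultimately show ?thesis using infinite_super by blast
qed

lemma sum_less_4: "(\<Sum>m<4. g m) = g 0 + g 1 + g 2 + g (3::nat)" for g :: "nat \<Rightarrow> complex"
  by (simp add: numeral_eq_Suc lessThan_Suc add_ac)

lemma ten_delta_add:
  "\<exists>e. \<forall>x y. (\<forall>w. ten (\<lambda>_ i j. delta i j + w * P i j) x y = (\<Sum>k\<le>4. e k x y * w ^ k))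
     \<and> e (1::nat) x y = site_sum P x y"
proof -
  define D where "D = (\<lambda>m x y. delta (x!m) (y!m))"
  define Q where "Q = (\<lambda>m x y. P (x!m) (y!m))"
  \<comment> \<open>Coefficient \<open>k\<close> sums over the choices of the \<open>k\<close> sites
    that carry \<open>P\<close>, the remaining sites carrying the identity.\<close>
  define e where "e = (\<lambda>k x y.
    if k = 0 then D 0 x y * D 1 x y * D 2 x y * D 3 x y
    else if k = Suc 0 then site_sum P x y
    else if k = 2 then
      Q 0 x y * Q 1 x y * D 2 x y * D 3 x y + Q 0 x y * D 1 x y * Q 2 x y * D 3 x y +
      Q 0 x y * D 1 x y * D 2 x y * Q 3 x y + D 0 x y * Q 1 x y * Q 2 x y * D 3 x y +
      D 0 x y * Q 1 x y * D 2 x y * Q 3 x y + D 0 x y * D 1 x y * Q 2 x y * Q 3 x y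
    else if k = 3 then
      D 0 x y * Q 1 x y * Q 2 x y * Q 3 x y + Q 0 x y * D 1 x y * Q 2 x y * Q 3 x y +
      Q 0 x y * Q 1 x y * D 2 x y * Q 3 x y + Q 0 x y * Q 1 x y * Q 2 x y * D 3 x y
    else Q 0 x y * Q 1 x y * Q 2 x y * Q 3 x y)"
  have s: "site_sum P x y = Q 0 x y * D 1 x y * D 2 x y * D 3 x y + D 0 x y * Q 1 x y * D 2 x y * D 3 x y
      + D 0 x y * D 1 x y * Q 2 x y * D 3 x y + D 0 x y * D 1 x y * D 2 x y * Q 3 x y" for x y
    by (simp add: site_sum_def site_def ten_def prod_less_4 sum_less_4 Q_def D_def)
  have "ten (\<lambda>_ i j. delta i j + w * P i j) x y = (\<Sum>k\<le>4. e k x y * w ^ k)" for w x y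
  proof -
    have t: "ten (\<lambda>_ i j. delta i j + w * P i j) x y =
      (D 0 x y + w * Q 0 x y) * (D 1 x y + w * Q 1 x y) * (D 2 x y + w * Q 2 x y) * (D 3 x y + w * Q 3 x y)"
      by (simp add: ten_def prod_less_4 Q_def D_def)
    have a: "(\<Sum>k\<le>4. e k x y * w ^ k) = e 0 x y + e (Suc 0) x y * w + e 2 x y * w ^ 2 + e 3 x y * w ^ 3 + e 4 x y * w ^ 4"
      by (simp add: numeral_eq_Suc)
    show ?thesis unfolding t a unfolding e_def s
      by (simp add: algebra_simps power2_eq_square power3_eq_cube power4_eq_xxxx)
  qed
  then show ?thesis by (intro exI[of _ e]) (auto simp: e_def)
qed

definition is_unitary :: "nat \<Rightarrow> cmat \<Rightarrow> bool" where
  "is_unitary d V \<longleftrightarrow> (\<forall>i<d. \<forall>j<d. (\<Sum>k<d. cnj (V k i) * V k j) = delta i j)"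

text \<open>For a Hermitian projection, 1 + w P is unitary for every w with
  \<open>cmod (1 + w) = 1\<close>. This is an infinite set, while each entry of the commutator is a
  polynomial of degree at most 4 in w; so all its coefficients vanish, the linear one included. This
  replaces differentiating a one-parameter group at the identity.\<close>

lemma commutes_projection:
  assumes T: "\<And>V. is_unitary d V \<Longrightarrow> commutes d T (ten (\<lambda>_. V))"
    and P2: "\<And>i j. i < d \<Longrightarrow> j < d \<Longrightarrow> (\<Sum>k<d. P i k * P k j) = P i j"
    and Ph: "\<And>i j. i < d \<Longrightarrow> j < d \<Longrightarrow> cnj (P i j) = P j i"
  shows "commutes d T (site_sum P)"
proof -
  obtain e where e: "\<And>w x y. ten (\<lambda>_ i j. delta i j + w * P i j) x y = (\<Sum>k\<le>4. e k x y * w ^ k)"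
    and e1: "\<And>x y. e (1::nat) x y = site_sum P x y"
    using ten_delta_add[of P] by metis
  have u: "is_unitary d (\<lambda>i j. delta i j + w * P i j)" if w: "cmod (1 + w) = 1" for w
    unfolding is_unitary_def
  proof (intro allI impI)
    fix i j assume ij: "i < d" "j < d"
    have "(1 + w) * cnj (1 + w) = 1" using w by (simp add: complex_norm_square[symmetric] del: complex_cnj_add)
    \<comment> \<open>This number is the coefficient of \<open>P\<close> in the product of the
      adjoint of 1 + w P with 1 + w P.\<close>
    then have ww: "w + cnj w + cnj w * w = 0" by (simp add: algebra_simps)
    have "(\<Sum>k<d. cnj (delta k i + w * P k i) * (delta k j + w * P k j)) =
        (\<Sum>k<d. delta i k * (delta k j + w * P k j) + cnj w * (P i k * delta k j) + cnj w * w * (P i k * P k j))"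
      using ij by (intro sum.cong) (auto simp: Ph algebra_simps delta_def)
    also have "\<dots> = delta i j + w * P i j + cnj w * P i j + cnj w * w * P i j"
      using ij by (simp add: sum.distrib sum_delta_left sum_delta_right P2 flip: sum_distrib_left)
    also have "\<dots> = delta i j + (w + cnj w + cnj w * w) * P i j" by (simp add: algebra_simps)
    finally show "(\<Sum>k<d. cnj (delta k i + w * P k i) * (delta k j + w * P k j)) = delta i j"
      unfolding ww by simp
  qed
  show ?thesis unfolding commutes_def
  proof (intro ballI)
    fix x z assume xz: "x \<in> tuples d" "z \<in> tuples d"
    define c where "c k = (\<Sum>y\<in>tuples d. T x y * e k y z) - (\<Sum>y\<in>tuples d. e k x y * T y z)" for k
    have "(\<Sum>k\<le>4. c k * w ^ k) = 0" if w: "cmod (1 + w) = 1" for w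
    proof -
      have "(\<Sum>y\<in>tuples d. T x y * (\<Sum>k\<le>4. e k y z * w ^ k)) = (\<Sum>y\<in>tuples d. (\<Sum>k\<le>4. e k x y * w ^ k) * T y z)"
        using T[OF u[OF w]] xz unfolding commutes_def e by blast
      moreover have "(\<Sum>y\<in>tuples d. T x y * (\<Sum>k\<le>4. e k y z * w ^ k)) = (\<Sum>k\<le>4. (\<Sum>y\<in>tuples d. T x y * e k y z) * w ^ k)"
        by (simp only: sum_distrib_left sum_distrib_right mult.assoc) (rule sum.swap)
      moreover have "(\<Sum>y\<in>tuples d. (\<Sum>k\<le>4. e k x y * w ^ k) * T y z) = (\<Sum>k\<le>4. (\<Sum>y\<in>tuples d. e k x y * T y z) * w ^ k)"
        by (simp only: sum_distrib_left sum_distrib_right mult.assoc mult.commute[of "w ^ _"]) (rule sum.swap)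
      ultimately show ?thesis by (simp only: c_def left_diff_distrib sum_subtractf) simp
    qed
    then have "{w. cmod (1 + w) = 1} \<subseteq> {w. (\<Sum>k\<le>4. c k * w ^ k) = 0}" by (rule Collect_mono[OF impI])
    then have "infinite {w. (\<Sum>k\<le>4. c k * w ^ k) = 0}"
      by (rule infinite_super[OF _ infinite_unit_circle_shift])
    then have "\<forall>k\<le>4. c k = 0" unfolding polyfun_finite_roots by blast
    then have "c 1 = 0" by simp
    then show "(\<Sum>y\<in>tuples d. T x y * site_sum P y z) = (\<Sum>y\<in>tuples d. site_sum P x y * T y z)"
      unfolding c_def e1 by simp
  qed
qed

lemma site_sum_linear:
  "site_sum (\<lambda>i j. \<Sum>k\<in>K. c k * A k i j) x y = (\<Sum>k\<in>K. c k * site_sum (A k) x y)"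
  by (simp add: site_sum_def site_def ten_def prod_less_4 sum_less_4 sum.distrib sum_distrib_left sum_distrib_right algebra_simps)

lemma site_sum_cong:
  assumes "x \<in> tuples d" "y \<in> tuples d" "\<And>i j. i < d \<Longrightarrow> j < d \<Longrightarrow> A i j = B i j"
  shows "site_sum A x y = site_sum B x y"
  unfolding site_sum_def site_def
  by (intro sum.cong refl ten_cong[OF assms(1,2)]) (use assms(3) in auto)

lemma commutes_rank_one:
  assumes T: "\<And>V. is_unitary d V \<Longrightarrow> commutes d T (ten (\<lambda>_. V))"
  shows "commutes d T (site_sum (\<lambda>i j. v i * cnj (v j)))"
proof -
  define n where "n = (\<Sum>k<d. cnj (v k) * v k)"
  \<comment> \<open>A one-element index set, so that scaling by \<open>n\<close> is an instance of
    \<open>commutes_sum\<close> and \<open>site_sum_linear\<close>.\<close>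
  define K :: "nat set" where "K = {0}"
  have nr: "cnj n = n" by (simp add: n_def mult.commute)
  show ?thesis
  proof (cases "n = 0")
    case True
    have "Re n = (\<Sum>k<d. (cmod (v k))\<^sup>2)"
      by (simp add: n_def cmod_power2) (simp add: power2_eq_square)
    then have "v k = 0" if "k < d" for k using True that by (simp add: sum_nonneg_eq_0_iff)
    \<comment> \<open>The zero matrix is written as an empty sum to bring it under
      \<open>site_sum_linear\<close>; the summand is arbitrary.\<close>
    then have "site_sum (\<lambda>i j. v i * cnj (v j)) x y = site_sum (\<lambda>i j. \<Sum>k\<in>{}. 0 * delta i j) x y"
      if "x \<in> tuples d" "y \<in> tuples d" for x y
      by (intro site_sum_cong[OF that]) auto
    then have "commutes d T (site_sum (\<lambda>i j. v i * cnj (v j))) \<longleftrightarrow> commutes d T (\<lambda>x y. 0)"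
      by (intro commutes_cong) (simp only: site_sum_linear, simp)
    then show ?thesis by (simp add: commutes_def)
  next
    case False
    define P where "P = (\<lambda>i j. v i * cnj (v j) / n)"
    have "(\<Sum>k<d. P i k * P k j) = P i j" for i j
    proof -
      have "(\<Sum>k<d. P i k * P k j) = (\<Sum>k<d. cnj (v k) * v k) * (v i * cnj (v j) / (n * n))"
        unfolding sum_distrib_right by (intro sum.cong) (simp_all add: P_def)
      then show ?thesis using False by (simp add: P_def n_def[symmetric])
    qed
    moreover have "cnj (P i j) = P j i" for i j by (simp add: P_def nr mult.commute)
    ultimately have "commutes d T (site_sum P)" by (intro commutes_projection[OF T]) auto
    then have "commutes d T (\<lambda>x y. \<Sum>k\<in>K. n * site_sum P x y)" by (intro commutes_sum)
    moreover have "(\<lambda>x y. \<Sum>k\<in>K. n * site_sum P x y) = site_sum (\<lambda>i j. \<Sum>k\<in>K. n * P i j)"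
      by (intro ext) (simp only: site_sum_linear)
    moreover have "(\<lambda>i j. \<Sum>k\<in>K. n * P i j) = (\<lambda>i j. v i * cnj (v j))"
      using False by (auto simp: P_def K_def)
    ultimately show ?thesis by simp
  qed
qed

text \<open>Polarisation over the fourth roots of unity: with the prefactor, the mixed term with row
  \<open>p\<close> and column \<open>q\<close> has weight \<i>^k times its conjugate, which is 1,
  while the other three terms have weights that sum to 0. Each summand is of the form handled by
  \<open>commutes_rank_one\<close>.\<close>

lemma munit_polarization:
  "munit p q i j = (\<Sum>k<4. \<i> ^ k / 4 * ((delta i p + \<i> ^ k * delta i q) * cnj (delta j p + \<i> ^ k * delta j q)))"
  by (simp add: sum_less_4 munit_def delta_def power3_eq_cube)

lemma commutes_site_sum:
  assumes T: "\<And>V. is_unitary d V \<Longrightarrow> commutes d T (ten (\<lambda>_. V))"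
  shows "commutes d T (site_sum B)"
proof -
  have m: "commutes d T (site_sum (munit p q))" for p q
  proof -
    have "commutes d T (\<lambda>x y. \<Sum>k<4. \<i> ^ k / 4 * site_sum (\<lambda>i j. (delta i p + \<i> ^ k * delta i q) * cnj (delta j p + \<i> ^ k * delta j q)) x y)"
      by (intro commutes_sum commutes_rank_one T)
    moreover have "site_sum (munit p q) = (\<lambda>x y. \<Sum>k<4. \<i> ^ k / 4 * site_sum (\<lambda>i j. (delta i p + \<i> ^ k * delta i q) * cnj (delta j p + \<i> ^ k * delta j q)) x y)"
      by (intro ext, subst site_sum_linear[symmetric], subst munit_polarization[symmetric]) (rule refl)
    ultimately show ?thesis by simp
  qed
  have "B i j = (\<Sum>k\<in>{..<d}\<times>{..<d}. B (fst k) (snd k) * munit (fst k) (snd k) i j)" if "i < d" "j < d" for i j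
  proof -
    have "(\<Sum>k\<in>{..<d}\<times>{..<d}. B (fst k) (snd k) * munit (fst k) (snd k) i j) =
        (\<Sum>k\<in>{..<d}\<times>{..<d}. if k = (i,j) then B i j else 0)"
      by (intro sum.cong) (auto simp: munit_def delta_def)
    then show ?thesis using that by simp
  qed
  then have "site_sum B x y = (\<Sum>k\<in>{..<d}\<times>{..<d}. B (fst k) (snd k) * site_sum (munit (fst k) (snd k)) x y)"
    if "x \<in> tuples d" "y \<in> tuples d" for x y
    unfolding site_sum_linear[symmetric] by (intro site_sum_cong[OF that])
  from commutes_cong[OF this, THEN iffD2, OF _ _ commutes_sum[OF m]] show ?thesis by blast
qed

section \<open>The commutant expressed through permutations\<close>

lemma gram_card: "p \<in> S4 \<Longrightarrow> (\<Sum>b\<in>tuples d. of_bool (b = act b p)) = complex_of_real (gram d p)"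
  unfolding ptr_delta[symmetric] ptr_def
  by (intro sum.cong refl) (simp add: ten_delta act_in_tuples)

text \<open>The commutation of \<open>T\<close> with the symmetrised elementary matrix of
  \<open>a\<close> and \<open>b\<close> is read at row \<open>x\<close> and column \<open>b\<close>,
  then summed over \<open>b\<close>. On the left, the number of tuples \<open>b\<close> fixed by
  \<open>p\<close> produces the Gram weights; on the right appear the traces of \<open>T\<close>
  against permutations.\<close>

lemma commutant_gram:
  assumes T: "\<And>V. is_unitary d V \<Longrightarrow> commutes d T (ten (\<lambda>_. V))"
    and x: "x \<in> tuples d" and a: "a \<in> tuples d"
  shows "(\<Sum>p\<in>S4. of_real (gram d p) * T x (act a p)) =
    (\<Sum>p\<in>S4. of_bool (x = act a p) * (\<Sum>b\<in>tuples d. T (act b p) b))"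
proof -
  have b: "(\<Sum>p\<in>S4. T x (act a p) * of_bool (b = act b p)) = (\<Sum>p\<in>S4. of_bool (x = act a p) * T (act b p) b)"
    if b: "b \<in> tuples d" for b
  proof -
    let ?S = "symten [munit (a!0) (b!0), munit (a!1) (b!1), munit (a!2) (b!2), munit (a!3) (b!3)] {..<4} (\<lambda>_. delta)"
    have "commutes d T ?S" by (intro commutes_symten commutes_site_sum T)
    then have "(\<Sum>y\<in>tuples d. T x y * ?S y b) = (\<Sum>y\<in>tuples d. ?S x y * T y b)"
      using x b by (simp only: commutes_def)
    moreover have "(\<Sum>y\<in>tuples d. T x y * ?S y b) =
        (\<Sum>p\<in>S4. \<Sum>y\<in>tuples d. T x y * (of_bool (y = act a p) * of_bool (b = act b p)))"
      by (subst sum.swap) (intro sum.cong refl, simp only: symten_munit[OF a b _ b] sum_distrib_left)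
    moreover have "(\<Sum>y\<in>tuples d. T x y * (of_bool (y = act a p) * of_bool (b = act b p))) =
       T x (act a p) * of_bool (b = act b p)" if "p \<in> S4" for p
    proof -
      have "(\<Sum>y\<in>tuples d. T x y * (of_bool (y = act a p) * of_bool (b = act b p))) =
        (\<Sum>y\<in>tuples d. if y = act a p then T x (act a p) * of_bool (b = act b p) else 0)"
        by (intro sum.cong) auto
      then show ?thesis using act_in_tuples[OF a that] by simp
    qed
    moreover have "(\<Sum>y\<in>tuples d. ?S x y * T y b) =
        (\<Sum>p\<in>S4. \<Sum>y\<in>tuples d. of_bool (x = act a p) * of_bool (y = act b p) * T y b)"
      by (subst sum.swap) (intro sum.cong refl, simp only: symten_munit[OF a b x] sum_distrib_right)
    moreover have "(\<Sum>y\<in>tuples d. of_bool (x = act a p) * of_bool (y = act b p) * T y b) =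
       of_bool (x = act a p) * T (act b p) b" if "p \<in> S4" for p
    proof -
      have "(\<Sum>y\<in>tuples d. of_bool (x = act a p) * of_bool (y = act b p) * T y b) =
        (\<Sum>y\<in>tuples d. if y = act b p then of_bool (x = act a p) * T (act b p) b else 0)"
        by (intro sum.cong) auto
      then show ?thesis using act_in_tuples[OF b that] by simp
    qed
    ultimately show ?thesis by simp
  qed
  have "(\<Sum>p\<in>S4. of_real (gram d p) * T x (act a p)) =
      (\<Sum>b\<in>tuples d. \<Sum>p\<in>S4. T x (act a p) * of_bool (b = act b p))"
    by (subst sum.swap) (intro sum.cong refl, simp only: gram_card mult.commute flip: sum_distrib_left)
  also have "\<dots> = (\<Sum>b\<in>tuples d. \<Sum>p\<in>S4. of_bool (x = act a p) * T (act b p) b)"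
    by (intro sum.cong refl b)
  also have "\<dots> = (\<Sum>p\<in>S4. of_bool (x = act a p) * (\<Sum>b\<in>tuples d. T (act b p) b))"
    by (subst sum.swap) (simp add: sum_distrib_left)
  finally show ?thesis .
qed

lemma sum_swap_3:
  fixes f :: "'a \<Rightarrow> 'b \<Rightarrow> 'c \<Rightarrow> complex"
  shows "(\<Sum>x\<in>A. \<Sum>s\<in>B. \<Sum>p\<in>C. f x s p) = (\<Sum>s\<in>B. \<Sum>p\<in>C. \<Sum>x\<in>A. f x s p)"
proof -
  have "(\<Sum>x\<in>A. \<Sum>s\<in>B. \<Sum>p\<in>C. f x s p) = (\<Sum>s\<in>B. \<Sum>x\<in>A. \<Sum>p\<in>C. f x s p)" by (rule sum.swap)
  also have "\<dots> = (\<Sum>s\<in>B. \<Sum>p\<in>C. \<Sum>x\<in>A. f x s p)" by (rule sum.cong[OF refl sum.swap])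
  finally show ?thesis .
qed

text \<open>Convolving \<open>commutant_gram\<close> with \<open>W\<close> recovers the entries of
  \<open>T\<close> from its 24 traces against permutations. Contracting with any \<open>R\<close>
  then leaves only such traces of \<open>T\<close> and of \<open>R\<close>.\<close>

lemma commutant_trace:
  assumes T: "\<And>V. is_unitary d V \<Longrightarrow> commutes d T (ten (\<lambda>_. V))"
    and W: "gram_inverse d W"
  shows "(\<Sum>a\<in>tuples d. \<Sum>x\<in>tuples d. R a x * T x a) =
    (\<Sum>s\<in>S4. \<Sum>p\<in>S4. of_real (W s) * (\<Sum>b\<in>tuples d. T (act b p) b) *
       (\<Sum>a\<in>tuples d. R a (act a (act s p))))"
proof -
  let ?t = "\<lambda>p. \<Sum>b\<in>tuples d. T (act b p) b"
  have 1: "T x a = (\<Sum>s\<in>S4. \<Sum>p\<in>S4. of_real (W s) * ?t p * of_bool (x = act a (act s p)))"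
    if x: "x \<in> tuples d" and a: "a \<in> tuples d" for x a
  proof -
    \<comment> \<open>\<open>gram_inverse\<close> is used with the row \<open>T x\<close> as the
      function \<open>F\<close>.\<close>
    have "T x a = (\<Sum>s\<in>S4. \<Sum>p\<in>S4. of_real (W s * gram d p) * T x (act (act a s) p))"
      using W a by (simp add: gram_inverse_def)
    also have "\<dots> = (\<Sum>s\<in>S4. of_real (W s) * (\<Sum>p\<in>S4. of_real (gram d p) * T x (act (act a s) p)))"
      by (simp add: sum_distrib_left mult.assoc)
    also have "\<dots> = (\<Sum>s\<in>S4. of_real (W s) * (\<Sum>p\<in>S4. of_bool (x = act (act a s) p) * ?t p))"
      using commutant_gram[OF T x] act_in_tuples[OF a] by simp
    also have "\<dots> = (\<Sum>s\<in>S4. \<Sum>p\<in>S4. of_real (W s) * ?t p * of_bool (x = act a (act s p)))"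
      unfolding sum_distrib_left by (intro sum.cong refl) (simp add: act_assoc_S4)
    finally show ?thesis .
  qed
  have 2: "(\<Sum>x\<in>tuples d. R a x * T x a) = (\<Sum>s\<in>S4. \<Sum>p\<in>S4. of_real (W s) * ?t p * R a (act a (act s p)))"
    if a: "a \<in> tuples d" for a
  proof -
    have "(\<Sum>x\<in>tuples d. R a x * T x a) =
        (\<Sum>x\<in>tuples d. \<Sum>s\<in>S4. \<Sum>p\<in>S4. R a x * (of_real (W s) * ?t p * of_bool (x = act a (act s p))))"
      by (intro sum.cong refl) (simp only: 1[OF _ a] sum_distrib_left)
    also have "\<dots> = (\<Sum>s\<in>S4. \<Sum>p\<in>S4. \<Sum>x\<in>tuples d. R a x * (of_real (W s) * ?t p * of_bool (x = act a (act s p))))"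
      by (rule sum_swap_3)
    also have "\<dots> = (\<Sum>s\<in>S4. \<Sum>p\<in>S4. of_real (W s) * ?t p * R a (act a (act s p)))"
    proof (intro sum.cong refl)
      fix s p assume sp: "s \<in> S4" "p \<in> S4"
      have "(\<Sum>x\<in>tuples d. R a x * (of_real (W s) * ?t p * of_bool (x = act a (act s p)))) =
         (\<Sum>x\<in>tuples d. if x = act a (act s p) then of_real (W s) * ?t p * R a (act a (act s p)) else 0)"
        by (intro sum.cong) auto
      then show "(\<Sum>x\<in>tuples d. R a x * (of_real (W s) * ?t p * of_bool (x = act a (act s p)))) =
          of_real (W s) * ?t p * R a (act a (act s p))"
        using act_in_tuples[OF a act_in_S4[OF sp]] by simp
    qed
    finally show ?thesis .
  qed
  have "(\<Sum>a\<in>tuples d. \<Sum>x\<in>tuples d. R a x * T x a) =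
     (\<Sum>a\<in>tuples d. \<Sum>s\<in>S4. \<Sum>p\<in>S4. of_real (W s) * ?t p * R a (act a (act s p)))"
    by (intro sum.cong refl 2)
  also have "\<dots> = (\<Sum>s\<in>S4. \<Sum>p\<in>S4. \<Sum>a\<in>tuples d. of_real (W s) * ?t p * R a (act a (act s p)))"
    by (rule sum_swap_3)
  finally show ?thesis by (simp only: sum_distrib_left)
qed

section \<open>Unitary matrices and conjugation\<close>

definition madj :: "cmat \<Rightarrow> cmat" where
  "madj A i j = cnj (A j i)"

definition conjugated :: "nat \<Rightarrow> cmat \<Rightarrow> cmat \<Rightarrow> cmat" where
  "conjugated d U B = mprod d (mprod d U B) (madj U)"

lemma mprod_assoc: "mprod d (mprod d A B) C = mprod d A (mprod d B C)"
  unfolding mprod_def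
  by (intro ext) (simp add: sum_distrib_left sum_distrib_right mult.assoc, rule sum.swap)

lemma mprod_cong:
  "(\<And>k. k < d \<Longrightarrow> A i k = A' i k) \<Longrightarrow> (\<And>k. k < d \<Longrightarrow> B k j = B' k j) \<Longrightarrow> mprod d A B i j = mprod d A' B' i j"
  by (simp add: mprod_def)

lemma madj_mprod: "madj (mprod d A B) = mprod d (madj B) (madj A)"
  by (intro ext) (simp add: madj_def mprod_def mult.commute)

lemma madj_madj [simp]: "madj (madj A) = A"
  by (intro ext) (simp add: madj_def)

lemma is_unitary_iff: "is_unitary d U \<longleftrightarrow> (\<forall>i<d. \<forall>j<d. mprod d (madj U) U i j = delta i j)"
  by (simp add: is_unitary_def mprod_def madj_def)

text \<open>A left inverse is a right inverse: \<open>1 - U U\<^sup>*\<close> has squared Hilbert--Schmidt norm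
  \<open>tr 1 - 2 tr U\<^sup>*U + tr (U\<^sup>*U)\<^sup>2 = 0\<close>.\<close>

lemma is_unitary_right:
  assumes U: "is_unitary d U" and ij: "i < d" "j < d"
  shows "mprod d U (madj U) i j = delta i j"
proof -
  let ?E = "mprod d U (madj U)"
  have U': "(\<Sum>k<d. cnj (U k i) * U k j) = delta i j" if "i < d" "j < d" for i j
    using U that by (simp add: is_unitary_def)
  have tE: "(\<Sum>i<d. ?E i i) = of_nat d"
  proof -
    have "(\<Sum>i<d. ?E i i) = (\<Sum>k<d. \<Sum>i<d. cnj (U i k) * U i k)"
      unfolding mprod_def madj_def by (subst sum.swap) (simp add: mult.commute)
    also have "\<dots> = of_nat d" by (simp add: U' delta_def)
    finally show ?thesis .
  qed
  have EE: "mprod d ?E ?E i j = ?E i j" if "i < d" "j < d" for i j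
  proof -
    have "mprod d ?E ?E i j = mprod d U (mprod d (mprod d (madj U) U) (madj U)) i j"
      by (simp add: mprod_assoc)
    also have "\<dots> = mprod d U (mprod d delta (madj U)) i j"
      using U by (intro mprod_cong refl) (auto simp: is_unitary_iff)
    also have "\<dots> = ?E i j" by (intro mprod_cong refl) (simp add: mprod_delta_left)
    finally show ?thesis .
  qed
  have Eh: "cnj (?E i j) = ?E j i" for i j
    using arg_cong[OF madj_mprod[of d U "madj U"], of "\<lambda>A. A j i"] by (simp add: madj_def)
  have "complex_of_real (\<Sum>i<d. \<Sum>j<d. (cmod (?E i j - delta i j))\<^sup>2) =
      (\<Sum>i<d. \<Sum>j<d. (?E i j - delta i j) * (?E j i - delta j i))"
    unfolding of_real_sum
  proof (intro sum.cong refl)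
    fix i j
    have "cnj (?E i j - delta i j) = ?E j i - delta j i" by (simp add: Eh delta_def eq_commute)
    then show "complex_of_real ((cmod (?E i j - delta i j))\<^sup>2) = (?E i j - delta i j) * (?E j i - delta j i)"
      by (simp only: complex_norm_square)
  qed
  also have "\<dots> = (\<Sum>i<d. (\<Sum>j<d. ?E i j * ?E j i) - (\<Sum>j<d. ?E i j * delta j i) - (\<Sum>j<d. delta i j * ?E j i) + (\<Sum>j<d. delta i j * delta j i))"
    by (simp add: algebra_simps sum.distrib sum_subtractf)
  also have "\<dots> = (\<Sum>i<d. ?E i i - ?E i i - ?E i i + delta i i)"
    using EE by (intro sum.cong refl) (simp add: sum_delta_left sum_delta_right mprod_def[of d ?E ?E])
  also have "\<dots> = 0" using tE by (simp add: sum_subtractf delta_def)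
  finally have "(\<Sum>i<d. \<Sum>j<d. (cmod (?E i j - delta i j))\<^sup>2) = 0" by (simp only: of_real_eq_0_iff)
  then have "(\<Sum>j<d. (cmod (?E i j - delta i j))\<^sup>2) = 0"
    using ij by (subst (asm) sum_nonneg_eq_0_iff) (auto intro: sum_nonneg)
  then show ?thesis using ij by (subst (asm) sum_nonneg_eq_0_iff) auto
qed

lemma is_unitary_inverse_pair: "is_unitary d A \<Longrightarrow> inverse_pair d A (madj A)"
  using is_unitary_right[of d A] by (auto simp: inverse_pair_def is_unitary_iff)

lemma is_unitary_mprod:
  assumes "is_unitary d A" "is_unitary d B"
  shows "is_unitary d (mprod d A B)"
  unfolding is_unitary_iff
proof (intro allI impI)
  fix i j assume ij: "i < d" "j < d"
  have "mprod d (madj (mprod d A B)) (mprod d A B) i j = mprod d (madj B) (mprod d (mprod d (madj A) A) B) i j"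
    by (simp add: madj_mprod mprod_assoc)
  also have "\<dots> = mprod d (madj B) (mprod d delta B) i j"
    using assms(1) by (intro mprod_cong refl) (auto simp: is_unitary_iff)
  also have "\<dots> = mprod d (madj B) B i j" by (intro mprod_cong refl) (simp add: mprod_delta_left)
  finally show "mprod d (madj (mprod d A B)) (mprod d A B) i j = delta i j"
    using assms(2) ij by (simp add: is_unitary_iff)
qed

lemma is_unitary_madj: "is_unitary d A \<Longrightarrow> is_unitary d (madj A)"
  using is_unitary_right[of d A] by (auto simp: is_unitary_iff)

lemma madj_conjugated: "madj (conjugated d U B) = conjugated d U (madj B)"
  by (simp add: conjugated_def madj_mprod mprod_assoc)

lemma conjugated_mprod: "conjugated d (mprod d V U) B = mprod d (mprod d V (conjugated d U B)) (madj V)"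
  by (simp add: conjugated_def madj_mprod mprod_assoc)

lemma tr1_mprod: "tr1 d (mprod d A B) = tr2 d A B"
  by (simp add: tr1_def tr2_def mprod_def)

lemma tr2_commute: "tr2 d A B = tr2 d B A"
  unfolding tr2_def by (subst sum.swap) (simp add: mult.commute)

lemma tr1_conjugated:
  assumes "is_unitary d U"
  shows "tr1 d (conjugated d U B) = tr1 d B"
proof -
  have "tr1 d (conjugated d U B) = tr1 d (mprod d (mprod d (madj U) U) B)"
    unfolding conjugated_def tr1_mprod by (subst tr2_commute) (simp add: mprod_assoc flip: tr1_mprod)
  also have "\<dots> = tr1 d B" unfolding tr1_def
  proof (intro sum.cong refl)
    fix i assume "i \<in> {..<d}"
    then have "mprod d (mprod d (madj U) U) B i i = mprod d delta B i i"
      using assms by (intro mprod_cong refl) (auto simp: is_unitary_iff)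
    then show "mprod d (mprod d (madj U) U) B i i = B i i" using \<open>i \<in> _\<close> by (simp add: mprod_delta_left)
  qed
  finally show ?thesis .
qed

lemma tr2_conjugated:
  assumes "is_unitary d U"
  shows "tr2 d (conjugated d U B) (conjugated d U B) = tr2 d B B"
proof -
  have "tr2 d (conjugated d U B) (conjugated d U B) = tr1 d (mprod d (conjugated d U B) (conjugated d U B))"
    by (simp add: tr1_mprod)
  also have "\<dots> = tr1 d (conjugated d U (mprod d B B))"
    unfolding tr1_def
  proof (intro sum.cong refl)
    fix i
    have "mprod d (conjugated d U B) (conjugated d U B) i i =
      mprod d (mprod d U B) (mprod d (mprod d (madj U) U) (mprod d B (madj U))) i i"
      by (simp add: conjugated_def mprod_assoc)
    also have "\<dots> = mprod d (mprod d U B) (mprod d delta (mprod d B (madj U))) i i"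
      using assms by (intro mprod_cong refl) (auto simp: is_unitary_iff)
    also have "\<dots> = mprod d (mprod d U B) (mprod d B (madj U)) i i"
      by (rule mprod_cong[OF refl]) (simp add: mprod_delta_left)
    finally show "mprod d (conjugated d U B) (conjugated d U B) i i = conjugated d U (mprod d B B) i i"
      by (simp add: conjugated_def mprod_assoc)
  qed
  also have "\<dots> = tr2 d B B" unfolding tr1_conjugated[OF assms] tr1_mprod ..
  finally show ?thesis .
qed

lemma tr1_madj: "tr1 d (madj A) = cnj (tr1 d A)"
  by (simp add: tr1_def madj_def)

lemma tr2_madj: "tr2 d (madj A) (madj A) = cnj (tr2 d A A)"
  by (simp add: tr2_def madj_def mult.commute)

section \<open>Fourth powers of traces as contractions of tensors\<close>

definition mtp :: "cmat \<Rightarrow> cmat" where "mtp A i j = A j i"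

lemma tr_mtp: "tr1 d (mtp A) = tr1 d A" "tr2 d (mtp A) (mtp A) = tr2 d A A"
  by (simp_all add: tr1_def tr2_def mtp_def mult.commute)

definition four :: "cmat \<Rightarrow> nat \<Rightarrow> cmat" where
  "four A m = (if m < 2 then A else madj A)"

lemma ptr_four:
  assumes "is_unitary d A" "tr1 d A = 0" "p \<in> S4"
  shows "ptr d (four A) p = of_real (traceless_val d ((cmod (tr2 d A A))\<^sup>2) p)"
proof -
  have "ptr d (\<lambda>m. if m < 2 then A else madj A) p = of_real (traceless_val d ((cmod (tr2 d A A))\<^sup>2) p)"
  proof (rule ptr_traceless)
    show "inverse_pair d (madj A) A"
      using is_unitary_inverse_pair[OF is_unitary_madj[OF assms(1)]] by simp
    show "tr1 d (madj A) = 0" "tr1 d A = 0" "p \<in> S4" using assms by (simp_all add: tr1_madj)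
    show "tr2 d A A * tr2 d (madj A) (madj A) = complex_of_real ((cmod (tr2 d A A))\<^sup>2)"
      by (simp only: tr2_madj complex_norm_square)
  qed
  then show ?thesis by (simp only: four_def[abs_def])
qed

text \<open>The permutation sits on the row index, whereas \<open>ptr\<close> has it on the column
  index. Transposing every factor exchanges the two without inverting \<open>p\<close>, and the
  transpose of \<open>A\<close> is again a traceless unitary with the same trace of its
  square.\<close>

lemma sum_ten_transposed:
  assumes "is_unitary d A" "tr1 d A = 0" "p \<in> S4"
  shows "(\<Sum>b\<in>tuples d. ten (four A) (act b p) b) = of_real (traceless_val d ((cmod (tr2 d A A))\<^sup>2) p)"
proof -
  have u: "is_unitary d (mtp A)"
    unfolding is_unitary_iff
  proof (intro allI impI)
    fix i j assume ij: "i < d" "j < d"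
    have "mprod d (madj (mtp A)) (mtp A) i j = mprod d A (madj A) j i"
      by (simp add: mprod_def madj_def mtp_def mult.commute)
    then show "mprod d (madj (mtp A)) (mtp A) i j = delta i j"
      using is_unitary_right[OF assms(1)] ij by (simp add: delta_def eq_commute)
  qed
  have "four (mtp A) m i j = four A m j i" for m i j by (simp add: four_def madj_def mtp_def)
  then have "(\<Sum>b\<in>tuples d. ten (four A) (act b p) b) = ptr d (four (mtp A)) p"
    by (simp add: ptr_def ten_def)
  then show ?thesis using ptr_four[OF u _ assms(3)] assms(2) by (simp add: tr_mtp)
qed

lemma trace_power_four:
  "complex_of_real (cmod (tr2 d A B) ^ 4) =
    (\<Sum>a\<in>tuples d. \<Sum>x\<in>tuples d. ten (four A) a x * ten (four B) x a)"
proof -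
  have c: "tr2 d (madj A) (madj B) = cnj (tr2 d A B)"
    unfolding tr2_def madj_def by (simp, rule sum.swap)
  have "complex_of_real (cmod (tr2 d A B) ^ 4) = tr2 d A B * tr2 d A B * cnj (tr2 d A B) * cnj (tr2 d A B)"
  proof -
    have "complex_of_real (cmod (tr2 d A B) ^ 4) = complex_of_real ((cmod (tr2 d A B))\<^sup>2) * complex_of_real ((cmod (tr2 d A B))\<^sup>2)"
      by (simp flip: power_add)
    then show ?thesis unfolding complex_norm_square by (simp add: mult_ac)
  qed
  also have "\<dots> = (\<Prod>m<4. \<Sum>i<d. \<Sum>j<d. four A m i j * four B m j i)"
    unfolding c[symmetric] by (simp add: prod_less_4 four_def tr2_def)
  also have "\<dots> = (\<Sum>a\<in>tuples d. \<Prod>m<4. \<Sum>j<d. four A m (a!m) j * four B m j (a!m))"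
    by (rule sum_tuples_prod[symmetric])
  also have "\<dots> = (\<Sum>a\<in>tuples d. \<Sum>x\<in>tuples d. ten (four A) a x * ten (four B) x a)"
    unfolding ten_def prod.distrib[symmetric] by (intro sum.cong refl sum_tuples_prod[symmetric])
  finally show ?thesis .
qed

section \<open>Haar averages\<close>

abbreviation entries :: "cmatrix \<Rightarrow> cmat" where
  "entries U \<equiv> \<lambda>i j. U (i, j)"

lemma entries_mmul: "i < d \<Longrightarrow> j < d \<Longrightarrow> mmul d A B (i, j) = mprod d (entries A) (entries B) i j"
  by (simp add: mmul_def mprod_def idx_def)

lemma entries_adj: "i < d \<Longrightarrow> j < d \<Longrightarrow> adj d A (i, j) = madj (entries A) i j"
  by (simp add: adj_def madj_def idx_def)

lemma unitary_mat_is_unitary: 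
  assumes "unitary_mat d U"
  shows "is_unitary d (entries U)"
  unfolding is_unitary_iff
proof (intro allI impI)
  fix i j assume ij: "i < d" "j < d"
  have "mprod d (madj (entries U)) (entries U) i j = mmul d (adj d U) U (i, j)"
    unfolding entries_mmul[OF ij] using ij by (intro mprod_cong) (simp_all add: entries_adj)
  also have "\<dots> = delta i j" using assms ij by (simp add: unitary_mat_def idm_def idx_def delta_def)
  finally show "mprod d (madj (entries U)) (entries U) i j = delta i j" .
qed

lemma is_unitary_unitary_mat:
  assumes "is_unitary d V"
  shows "unitary_mat d (restrict (\<lambda>(i,j). V i j) (idx d))"
proof -
  let ?V = "restrict (\<lambda>(i,j). V i j) (idx d)"
  have "mmul d (adj d ?V) ?V = idm d"
  proof
    fix ij :: "nat \<times> nat"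
    obtain i j where ij: "ij = (i, j)" by fastforce
    show "mmul d (adj d ?V) ?V ij = idm d ij"
    proof (cases "i < d \<and> j < d")
      case True
      then have "mmul d (adj d ?V) ?V (i,j) = mprod d (madj V) V i j"
        by (subst entries_mmul; (intro mprod_cong)?) (auto simp: entries_adj madj_def idx_def)
      then show ?thesis using True assms ij by (simp add: is_unitary_iff idm_def idx_def delta_def)
    next
      case False
      then show ?thesis by (auto simp: ij mmul_def idm_def idx_def)
    qed
  qed
  then show ?thesis by (simp add: unitary_mat_def)
qed

lemma is_unitary_entry_le:
  assumes "is_unitary d U" "i < d" "j < d"
  shows "cmod (U i j) \<le> 1"
proof -
  have "complex_of_real (\<Sum>k<d. (cmod (U k j))\<^sup>2) = (\<Sum>k<d. cnj (U k j) * U k j)"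
    unfolding of_real_sum complex_norm_square by (simp add: mult.commute)
  also have "\<dots> = 1" using assms by (simp add: is_unitary_def delta_def)
  finally have "(\<Sum>k<d. (cmod (U k j))\<^sup>2) = 1" by (metis of_real_eq_1_iff)
  moreover have "(cmod (U i j))\<^sup>2 \<le> (\<Sum>k<d. (cmod (U k j))\<^sup>2)"
    using assms by (intro member_le_sum) auto
  ultimately show ?thesis by (simp add: abs_square_le_1)
qed

text \<open>A crude bound independent of \<open>U\<close>, from the fact that entries of a unitary
  have modulus at most 1. It supplies the constant that dominates the integrands below.\<close>

lemma conjugated_entry_le:
  assumes U: "is_unitary d U" and "i < d" "j < d"
  shows "cmod (conjugated d U B i j) \<le> (\<Sum>k<d. \<Sum>l<d. cmod (B l k))"
proof -
  have "cmod (conjugated d U B i j) \<le> (\<Sum>k<d. cmod (mprod d U B i k * madj U k j))"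
    unfolding conjugated_def mprod_def[of d "mprod d U B"] by (rule norm_sum)
  also have "\<dots> \<le> (\<Sum>k<d. \<Sum>l<d. cmod (B l k))"
  proof (rule sum_mono)
    fix k assume k: "k \<in> {..<d}"
    have "cmod (mprod d U B i k) \<le> (\<Sum>l<d. cmod (U i l * B l k))"
      unfolding mprod_def by (rule norm_sum)
    also have "\<dots> \<le> (\<Sum>l<d. cmod (B l k))"
      using is_unitary_entry_le[OF U \<open>i < d\<close>]
      by (intro sum_mono) (auto simp: norm_mult intro: mult_left_le_one_le)
    finally have 1: "cmod (mprod d U B i k) \<le> (\<Sum>l<d. cmod (B l k))" .
    have "cmod (madj U k j) \<le> 1" using is_unitary_entry_le[OF U \<open>j < d\<close>] k by (simp add: madj_def)
    then have "cmod (mprod d U B i k) * cmod (madj U k j) \<le> cmod (mprod d U B i k)"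
      by (intro mult_left_le) auto
    then show "cmod (mprod d U B i k * madj U k j) \<le> (\<Sum>l<d. cmod (B l k))"
      using 1 by (simp add: norm_mult)
  qed
  finally show ?thesis .
qed

lemma haar_prob_space: "haar_measure d M \<Longrightarrow> prob_space M"
  by (simp add: haar_measure_def)

lemma haar_AE: "haar_measure d M \<Longrightarrow> AE U in M. is_unitary d (entries U)"
  by (auto simp: haar_measure_def intro: unitary_mat_is_unitary)

lemma measurable_entry [measurable]:
  assumes "haar_measure d M" "i < d" "j < d"
  shows "(\<lambda>U. U (i, j)) \<in> borel_measurable M"
proof -
  have "(\<lambda>U. U (i, j)) \<in> borel_measurable (mat_space d)"
    unfolding mat_space_def using assms by (intro measurable_component_singleton) (simp add: idx_def)
  then show ?thesis using assms(1) by (simp add: haar_measure_def cong: measurable_cong_sets)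
qed

lemma measurable_mmul:
  assumes H: "haar_measure d M"
  shows "mmul d V \<in> measurable M M"
proof -
  have "mmul d V \<in> measurable M (mat_space d)"
    unfolding mat_space_def mmul_def[abs_def]
  proof (rule measurable_restrict)
    fix p assume "p \<in> idx d"
    then obtain i j where p: "p = (i, j)" "i < d" "j < d" by (auto simp: idx_def)
    show "(\<lambda>U. case p of (i, j) \<Rightarrow> \<Sum>k<d. V (i, k) * U (k, j)) \<in> borel_measurable M"
      unfolding p(1) prod.case
      by (intro borel_measurable_sum borel_measurable_times borel_measurable_const measurable_entry[OF H])
         (use p in auto)
  qed
  then show ?thesis using H by (simp add: haar_measure_def cong: measurable_cong_sets)
qed

lemma haar_left_invariant:
  fixes f :: "cmatrix \<Rightarrow> complex"
  assumes "haar_measure d M" "unitary_mat d V" "f \<in> borel_measurable M"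
  shows "(\<integral>U. f (mmul d V U) \<partial>M) = (\<integral>U. f U \<partial>M)"
proof -
  have "distr M M (mmul d V) = M" using assms(1,2) by (simp add: haar_measure_def)
  then have "(\<integral>U. f U \<partial>M) = (\<integral>U. f U \<partial>distr M M (mmul d V))" by simp
  also have "\<dots> = (\<integral>U. f (mmul d V U) \<partial>M)"
    by (rule integral_distr[OF measurable_mmul[OF assms(1)] assms(3)])
  finally show ?thesis by simp
qed

lemma measurable_conjugated:
  assumes H: "haar_measure d M" and "i < d" "j < d"
  shows "(\<lambda>U. conjugated d (entries U) B i j) \<in> borel_measurable M"
proof -
  have "(\<lambda>U. cnj (U (j, k))) \<in> borel_measurable M" if "k < d" for k
    by (rule borel_measurable_continuous_on[OF _ measurable_entry[OF H \<open>j < d\<close> that]])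
       (intro continuous_intros)
  then show ?thesis
    unfolding conjugated_def mprod_def madj_def
    by (intro borel_measurable_sum borel_measurable_times borel_measurable_const
        measurable_entry[OF H]) (use assms in auto)
qed

lemma measurable_ten_conjugated:
  assumes H: "haar_measure d M" and "x \<in> tuples d" "y \<in> tuples d"
  shows "(\<lambda>U. ten (four (conjugated d (entries U) B)) x y) \<in> borel_measurable M"
  unfolding ten_def
proof (intro borel_measurable_prod)
  fix m :: nat assume "m \<in> {..<4}"
  then show "(\<lambda>U. four (conjugated d (entries U) B) m (x ! m) (y ! m)) \<in> borel_measurable M"
    using assms measurable_conjugated[OF H]
    by (cases "m < 2") (auto simp: four_def madj_conjugated tuples_nth)
qed

lemma integrable_ten_conjugated:
  assumes H: "haar_measure d M" and xy: "x \<in> tuples d" "y \<in> tuples d"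
  shows "integrable M (\<lambda>U. ten (four (conjugated d (entries U) B)) x y)"
proof -
  interpret prob_space M using haar_prob_space[OF H] .
  define c where "c m = (\<Sum>k<d. \<Sum>l<d. cmod (four B m l k))" for m
  show ?thesis
  proof (rule integrable_const_bound)
    show "AE U in M. norm (ten (four (conjugated d (entries U) B)) x y) \<le> (\<Prod>m<4. c m)"
      using haar_AE[OF H]
    proof eventually_elim
      case (elim U)
      have "cmod (four (conjugated d (entries U) B) m (x ! m) (y ! m)) \<le> c m" if "m < 4" for m
        using conjugated_entry_le[OF elim, of "x ! m" "y ! m"] tuples_nth[OF xy(1) that] tuples_nth[OF xy(2) that]
        by (simp add: c_def four_def madj_conjugated)
      then show ?case unfolding ten_def prod_norm[symmetric] by (intro prod_mono) auto
    qed
  qed (rule measurable_ten_conjugated[OF H xy])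
qed

lemma mprod_mprod_madj:
  assumes "is_unitary d V" "j < d"
  shows "mprod d (mprod d A (madj V)) V i j = A i j"
proof -
  have "mprod d (mprod d A (madj V)) V i j = mprod d A (mprod d (madj V) V) i j" by (simp add: mprod_assoc)
  also have "\<dots> = mprod d A delta i j"
    using assms by (intro mprod_cong refl) (auto simp: is_unitary_iff)
  finally show ?thesis using assms by (simp add: mprod_delta_right)
qed

lemma four_mprod: "four (mprod d (mprod d V A) (madj V)) m = mprod d (mprod d V (four A m)) (madj V)"
  by (simp add: four_def madj_mprod mprod_assoc)

text \<open>Left invariance allows \<open>U\<close> to be replaced by V U, which conjugates the
  averaged tensor by the fourth tensor power of \<open>V\<close>. Multiplying on the right by that
  power cancels its adjoint. The integrals are taken entrywise, so integrability is needed only to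
  pull finite sums out.\<close>

lemma commutes_twirl:
  assumes H: "haar_measure d M" and V: "is_unitary d V"
  shows "commutes d (\<lambda>x y. \<integral>U. ten (four (conjugated d (entries U) B)) x y \<partial>M) (ten (\<lambda>_. V))"
  unfolding commutes_def
proof (intro ballI)
  fix x z assume xz: "x \<in> tuples d" "z \<in> tuples d"
  let ?N = "\<lambda>U. conjugated d (entries U) B"
  define V' where "V' = restrict (\<lambda>(i,j). V i j) (idx d)"
  have V'e: "V' (i, j) = V i j" if "i < d" "j < d" for i j using that by (simp add: V'_def idx_def)
  have inv: "(\<integral>U. ten (four (?N U)) x y \<partial>M) =
      (\<integral>U. ten (\<lambda>m. mprod d (mprod d V (four (?N U) m)) (madj V)) x y \<partial>M)" if y: "y \<in> tuples d" for y
  proof -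
    have "(\<integral>U. ten (four (?N U)) x y \<partial>M) = (\<integral>U. ten (four (?N (mmul d V' U))) x y \<partial>M)"
      unfolding V'_def
      by (rule haar_left_invariant[OF H is_unitary_unitary_mat[OF V] measurable_ten_conjugated[OF H xz(1) y], symmetric])
    also have "\<dots> = (\<integral>U. ten (\<lambda>m. mprod d (mprod d V (four (?N U) m)) (madj V)) x y \<partial>M)"
    proof (intro Bochner_Integration.integral_cong refl ten_cong[OF xz(1) y])
      fix U m i j assume ij: "(i::nat) < d" "j < d"
      have e: "mmul d V' U (i, j) = mprod d V (entries U) i j" if "i < d" "j < d" for i j
        unfolding entries_mmul[OF that] using that by (intro mprod_cong) (auto simp: V'e)
      have "?N (mmul d V' U) i j = conjugated d (mprod d V (entries U)) B i j" if "i < d" "j < d" for i j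
        unfolding conjugated_def using that by (intro mprod_cong) (auto simp: e madj_def)
      then have "four (?N (mmul d V' U)) m i j = four (conjugated d (mprod d V (entries U)) B) m i j"
        using ij by (simp add: four_def madj_def)
      then show "four (?N (mmul d V' U)) m i j = mprod d (mprod d V (four (?N U) m)) (madj V) i j"
        by (simp only: conjugated_mprod four_mprod)
    qed
    finally show ?thesis .
  qed
  have int': "integrable M (\<lambda>U. ten (\<lambda>m. mprod d (mprod d V (four (?N U) m)) (madj V)) x y)"
    if y: "y \<in> tuples d" for y
  proof -
    have "(\<lambda>U. ten (\<lambda>m. mprod d (mprod d V (four (?N U) m)) (madj V)) x y) =
      (\<lambda>U. \<Sum>u\<in>tuples d. (\<Sum>v\<in>tuples d. ten (\<lambda>_. V) x v * ten (four (?N U)) v u) * ten (\<lambda>_. madj V) u y)"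
      by (simp only: ten_mult)
    then show ?thesis
      by (simp only:) (intro Bochner_Integration.integrable_sum integrable_mult_left integrable_mult_right integrable_ten_conjugated[OF H])
  qed
  have "(\<Sum>y\<in>tuples d. (\<integral>U. ten (four (?N U)) x y \<partial>M) * ten (\<lambda>_. V) y z) =
      (\<Sum>y\<in>tuples d. (\<integral>U. ten (\<lambda>m. mprod d (mprod d V (four (?N U) m)) (madj V)) x y \<partial>M) * ten (\<lambda>_. V) y z)"
    by (intro sum.cong refl arg_cong2[where f=times] inv)
  also have "\<dots> = (\<integral>U. (\<Sum>y\<in>tuples d. ten (\<lambda>m. mprod d (mprod d V (four (?N U) m)) (madj V)) x y * ten (\<lambda>_. V) y z) \<partial>M)"
    by (subst Bochner_Integration.integral_sum) (simp_all add: int')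
  also have "\<dots> = (\<integral>U. (\<Sum>y\<in>tuples d. ten (\<lambda>_. V) x y * ten (four (?N U)) y z) \<partial>M)"
    unfolding ten_mult
    by (intro Bochner_Integration.integral_cong refl ten_cong[OF xz] mprod_mprod_madj[OF V])
  also have "\<dots> = (\<Sum>y\<in>tuples d. ten (\<lambda>_. V) x y * (\<integral>U. ten (four (?N U)) y z \<partial>M))"
    by (subst Bochner_Integration.integral_sum) (simp_all add: integrable_ten_conjugated[OF H] xz)
  finally show "(\<Sum>y\<in>tuples d. (\<integral>U. ten (four (?N U)) x y \<partial>M) * ten (\<lambda>_. V) y z) =
    (\<Sum>y\<in>tuples d. ten (\<lambda>_. V) x y * (\<integral>U. ten (four (?N U)) y z \<partial>M))" .
qed

lemma is_unitary_conjugated: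
  "is_unitary d U \<Longrightarrow> is_unitary d B \<Longrightarrow> is_unitary d (conjugated d U B)"
  unfolding conjugated_def by (intro is_unitary_mprod is_unitary_madj)

lemma integrable_trace_power_four:
  assumes H: "haar_measure d M"
  shows "integrable M (\<lambda>U. cmod (tr2 d A (conjugated d (entries U) B)) ^ 4)"
proof -
  have "integrable M (\<lambda>U. complex_of_real (cmod (tr2 d A (conjugated d (entries U) B)) ^ 4))"
    unfolding trace_power_four
    by (intro Bochner_Integration.integrable_sum integrable_mult_right integrable_ten_conjugated[OF H])
  then show ?thesis by (simp only: complex_of_real_integrable_eq)
qed

text \<open>The average never has to be evaluated entrywise: by \<open>commutant_trace\<close> only
  its traces against permutations matter. These are constant almost surely, since conjugation by a
  unitary preserves unitarity, the trace and the trace of the square of \<open>B\<close>.\<close>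

theorem haar_fourth_moment:
  assumes H: "haar_measure d M" and A: "is_unitary d A" "tr1 d A = 0"
    and B: "is_unitary d B" "tr1 d B = 0" and W: "gram_inverse d W"
  shows "(\<integral>U. cmod (tr2 d A (conjugated d (entries U) B)) ^ 4 \<partial>M) =
    (\<Sum>s\<in>S4. \<Sum>p\<in>S4. W s * traceless_val d ((cmod (tr2 d B B))\<^sup>2) p *
       traceless_val d ((cmod (tr2 d A A))\<^sup>2) (act s p))"
proof -
  interpret prob_space M using haar_prob_space[OF H] .
  let ?N = "\<lambda>U. conjugated d (entries U) B"
  define T where "T x y = (\<integral>U. ten (four (?N U)) x y \<partial>M)" for x y
  have t: "(\<Sum>b\<in>tuples d. T (act b p) b) = of_real (traceless_val d ((cmod (tr2 d B B))\<^sup>2) p)"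
    if p: "p \<in> S4" for p
  proof -
    have "(\<Sum>b\<in>tuples d. T (act b p) b) = (\<integral>U. (\<Sum>b\<in>tuples d. ten (four (?N U)) (act b p) b) \<partial>M)"
      unfolding T_def by (subst Bochner_Integration.integral_sum) (auto simp: act_in_tuples[OF _ p] intro!: integrable_ten_conjugated[OF H])
    also have "\<dots> = (\<integral>U. complex_of_real (traceless_val d ((cmod (tr2 d B B))\<^sup>2) p) \<partial>M)"
    proof (rule integral_cong_AE)
      show "AE U in M. (\<Sum>b\<in>tuples d. ten (four (?N U)) (act b p) b) = complex_of_real (traceless_val d ((cmod (tr2 d B B))\<^sup>2) p)"
        using haar_AE[OF H]
      proof eventually_elim
        case (elim U)
        have "tr1 d (?N U) = 0" using tr1_conjugated[OF elim] B by simp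
        from sum_ten_transposed[OF is_unitary_conjugated[OF elim B(1)] this p]
        show ?case by (simp only: tr2_conjugated[OF elim])
      qed
    qed (auto intro!: borel_measurable_sum measurable_ten_conjugated[OF H] act_in_tuples[OF _ p])
    also have "\<dots> = of_real (traceless_val d ((cmod (tr2 d B B))\<^sup>2) p)" by (simp add: prob_space)
    finally show ?thesis .
  qed
  have "complex_of_real (\<integral>U. cmod (tr2 d A (?N U)) ^ 4 \<partial>M) = (\<integral>U. complex_of_real (cmod (tr2 d A (?N U)) ^ 4) \<partial>M)"
    by (rule integral_complex_of_real[symmetric])
  also have "\<dots> = (\<Sum>a\<in>tuples d. \<Sum>x\<in>tuples d. ten (four A) a x * T x a)"
    unfolding trace_power_four T_def
    by (subst Bochner_Integration.integral_sum, (intro Bochner_Integration.integrable_sum integrable_mult_right integrable_ten_conjugated[OF H]; assumption),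
        intro sum.cong refl, subst Bochner_Integration.integral_sum,
        (intro integrable_mult_right integrable_ten_conjugated[OF H]; assumption), simp)
  also have "\<dots> = (\<Sum>s\<in>S4. \<Sum>p\<in>S4. of_real (W s) * (\<Sum>b\<in>tuples d. T (act b p) b) *
       (\<Sum>a\<in>tuples d. ten (four A) a (act a (act s p))))"
    unfolding T_def by (rule commutant_trace[OF commutes_twirl[OF H] W])
  also have "\<dots> = (\<Sum>s\<in>S4. \<Sum>p\<in>S4. of_real (W s) * of_real (traceless_val d ((cmod (tr2 d B B))\<^sup>2) p) *
       of_real (traceless_val d ((cmod (tr2 d A A))\<^sup>2) (act s p)))"
    by (intro sum.cong refl) (simp add: t ptr_four[OF A, unfolded ptr_def] act_in_S4)
  also have "\<dots> = complex_of_real (\<Sum>s\<in>S4. \<Sum>p\<in>S4. W s * traceless_val d ((cmod (tr2 d B B))\<^sup>2) p *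
       traceless_val d ((cmod (tr2 d A A))\<^sup>2) (act s p))"
    by (simp only: of_real_sum of_real_mult)
  finally show ?thesis by (simp only: of_real_eq_iff)
qed

text \<open>A sum over pairs of the nine surviving permutations. With q = \<open>[1,0,3,2]\<close>,
  which carries \<open>x\<close> and \<open>y\<close>: \<open>x * y\<close> needs s q = q, so s is
  the identity. A term linear in \<open>y\<close> has s = r q with r another surviving permutation:
  two double transpositions r give double transpositions s, two 4-cycles r give 4-cycles, and the
  other four give transpositions.\<close>

lemma weingarten_traceless_sum:
  "(\<Sum>s\<in>S4. \<Sum>p\<in>S4. class_fun wI wT wD w3 w4 s * traceless_val d y p * traceless_val d x (act s p)) =
    6 * (real d)\<^sup>2 * (wI + wD + 4 * w3) + 2 * real d ^ 4 * (wI + wD) + 2 * real d ^ 3 * (4 * w4 + 8 * wT)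
    + (2 * (real d)\<^sup>2 * wD + real d * (2 * w4 + 4 * wT)) * (x + y) + wI * x * y"
proof -
  have "(\<Sum>s\<in>S4. \<Sum>p\<in>S4. class_fun wI wT wD w3 w4 s * traceless_val d y p * traceless_val d x (act s p)) =
    (\<Sum>p\<in>S4. traceless_val d y p * (\<Sum>s\<in>S4. class_fun wI wT wD w3 w4 s * traceless_val d x (act s p)))"
    by (subst sum.swap) (simp add: sum_distrib_left mult_ac)
  also have "\<dots> = 6 * (real d)\<^sup>2 * (wI + wD + 4 * w3) + 2 * real d ^ 4 * (wI + wD) + 2 * real d ^ 3 * (4 * w4 + 8 * wT)
    + (2 * (real d)\<^sup>2 * wD + real d * (2 * w4 + 4 * wT)) * (x + y) + wI * x * y"
    unfolding sum_S4
    by (simp add: traceless_val_simps class_fun_simps nth_4 algebra_simps power2_eq_square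
        power3_eq_cube power4_eq_xxxx del: One_nat_def)
  finally show ?thesis .
qed

section \<open>Displacement operators\<close>

lemma digit_add_less: "j < n \<Longrightarrow> q < L ^ n \<Longrightarrow> digit L j (q + L ^ n * r) = digit L j q"
proof -
  assume "j < n" "q < L ^ n"
  then obtain k where k: "n = j + Suc k" by (metis less_iff_Suc_add add_Suc_right)
  have "(q + L ^ n * r) div L ^ j = (q + L ^ j * (L * (L ^ k * r))) div L ^ j"
    by (simp add: k power_add mult_ac)
  also have "\<dots> = q div L ^ j + L * (L ^ k * r)"
    using \<open>q < L ^ n\<close> by (subst div_mult_self2) (auto simp: k intro!: gr0I)
  finally show ?thesis by (simp add: digit_def)
qed

lemma digit_add_eq: "q < L ^ n \<Longrightarrow> r < L \<Longrightarrow> digit L n (q + L ^ n * r) = r"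
  by (simp add: digit_def)

lemma digit_less: "L > 0 \<Longrightarrow> digit L j k < L"
  by (simp add: digit_def)

text \<open>Writing an index as \<open>q + L ^ n * r\<close> splits off its leading digit. Sums over
  the basis of the tensor product thus become products over the sites, so unitarity and the traces
  of \<open>Dmat\<close> reduce to the one-qudit case.\<close>

lemma sum_digits:
  fixes f :: "nat \<Rightarrow> nat \<Rightarrow> 'a :: comm_semiring_1"
  assumes "L > 0"
  shows "(\<Sum>k<L ^ n. \<Prod>j<n. f j (digit L j k)) = (\<Prod>j<n. \<Sum>i<L. f j i)"
proof (induction n)
  case (Suc n)
  have "(\<Sum>k<L ^ Suc n. \<Prod>j<Suc n. f j (digit L j k)) =
      (\<Sum>(q,r)\<in>{..<L ^ n} \<times> {..<L}. \<Prod>j<Suc n. f j (digit L j (q + L ^ n * r)))"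
  proof (rule sum.reindex_bij_witness[of _ "\<lambda>(q,r). q + L ^ n * r" "\<lambda>k. (k mod L ^ n, k div L ^ n)"])
    fix k assume "k \<in> {..<L ^ Suc n}"
    then show "(k mod L ^ n, k div L ^ n) \<in> {..<L ^ n} \<times> {..<L}"
      using assms by (auto simp: less_mult_imp_div_less)
  next
    fix b assume "b \<in> {..<L ^ n} \<times> {..<L}"
    then obtain q r where b: "b = (q, r)" "q < L ^ n" "r < L" by auto
    have "q + L ^ n * r < L ^ n * Suc r" using b by simp
    also have "\<dots> \<le> L ^ n * L" using b by (intro mult_le_mono2) simp
    finally show "(case b of (q, r) \<Rightarrow> q + L ^ n * r) \<in> {..<L ^ Suc n}" by (simp add: b mult.commute)
  qed auto
  also have "\<dots> = (\<Sum>(q,r)\<in>{..<L ^ n} \<times> {..<L}. (\<Prod>j<n. f j (digit L j q)) * f n r)"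
    by (intro sum.cong refl) (auto simp: digit_add_less digit_add_eq)
  also have "\<dots> = (\<Prod>j<Suc n. \<Sum>i<L. f j i)"
    by (simp add: Suc.IH[symmetric] sum_product sum.cartesian_product)
  finally show ?case .
qed simp

lemma digits_eq:
  assumes "\<And>j. j < n \<Longrightarrow> digit L j k = digit L j l"
  shows "k mod L ^ n = l mod L ^ n"
  using assms
proof (induction n)
  case (Suc n)
  have "k mod L ^ Suc n = L ^ n * digit L n k + k mod L ^ n" for k
    by (simp add: digit_def mult.commute[of L] mod_mult2_eq)
  then show ?case using Suc by simp
qed simp

lemma delta_digits:
  assumes "k < L ^ n" "l < L ^ n"
  shows "(\<Prod>j<n. delta (digit L j k) (digit L j l)) = delta k l"
proof (cases "k = l")
  case False
  then obtain j where "j < n" "digit L j k \<noteq> digit L j l"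
    using digits_eq[of n L k l] assms by auto
  then show ?thesis using False by (auto simp: delta_def intro!: prod_zero)
qed (simp add: delta_def)

lemma norm_omega [simp]: "cmod (omega L) = 1"
proof -
  have "omega L = cis (2 * pi / L)" by (simp add: omega_def cis_conv_exp mult_ac)
  then show ?thesis by simp
qed

lemma norm_tau [simp]: "cmod (tau L) = 1"
proof -
  have "tau L = - cis (pi / L)" by (simp add: tau_def cis_conv_exp mult_ac)
  then show ?thesis by simp
qed

lemma omega_power_eq_1: "L > 0 \<Longrightarrow> omega L ^ m = 1 \<longleftrightarrow> L dvd m"
proof -
  assume L: "L > 0"
  have "omega L ^ m = exp (2 * of_real pi * \<i> * of_nat m / of_nat L)"
    by (simp add: omega_def mult_ac flip: exp_of_nat_mult)
  then show ?thesis using complex_root_unity_eq_1[of L m] L by simp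
qed

lemma sum_omega:
  assumes "L > 0"
  shows "(\<Sum>c<L. omega L ^ (m * c)) = (if L dvd m then of_nat L else 0)"
proof -
  have L: "omega L ^ (m * L) = 1" using assms by (simp add: omega_power_eq_1)
  show ?thesis
  proof (cases "L dvd m")
    case True
    then have "omega L ^ m = 1" using assms omega_power_eq_1 by blast
    then show ?thesis using True by (simp add: power_mult)
  next
    case False
    then have "omega L ^ m \<noteq> 1" using assms omega_power_eq_1 by blast
    then have "(\<Sum>c<L. (omega L ^ m) ^ c) = ((omega L ^ m) ^ L - 1) / (omega L ^ m - 1)"
      by (rule geometric_sum)
    then show ?thesis using False L by (simp add: power_mult)
  qed
qed

lemma add_mod_cancel: "c < L \<Longrightarrow> c' < L \<Longrightarrow> (c + a) mod L = (c' + a) mod (L::nat) \<longleftrightarrow> c = c'"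
proof (induction c c' rule: linorder_wlog)
  case (le c c')
  have "(c + a) mod L = (c' + a) mod L \<longleftrightarrow> L dvd c' - c"
    using mod_eq_dvd_iff_nat[of "c + a" "c' + a" L] le by (simp add: eq_commute)
  moreover have "c' - c = 0" if "L dvd c' - c"
    using that nat_dvd_not_less[of "c' - c" L] le by linarith
  ultimately show ?case using le by auto
qed auto

lemma Dq_unitary:
  assumes "c < L" "c' < L"
  shows "(\<Sum>r<L. cnj (Dq L a r c) * Dq L a r c') = delta c c'"
proof -
  have u: "cnj z * z = 1" if "cmod z = 1" for z
    using that by (metis complex_norm_square mult.commute of_real_1 one_power2)
  have "(\<Sum>r<L. cnj (Dq L a r c) * Dq L a r c') =
     (\<Sum>r<L. if r = (c + fst a) mod L then delta c c' else 0)"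
  proof (intro sum.cong refl)
    fix r assume "r \<in> {..<L}"
    have "cnj (tau L ^ (fst a * snd a) * omega L ^ (snd a * c)) * (tau L ^ (fst a * snd a) * omega L ^ (snd a * c)) = 1"
      by (rule u) (simp add: norm_mult norm_power)
    then show "cnj (Dq L a r c) * Dq L a r c' = (if r = (c + fst a) mod L then delta c c' else 0)"
      using add_mod_cancel[OF assms, of "fst a"] by (auto simp: Dq_def delta_def)
  qed
  then show ?thesis using assms by simp
qed

text \<open>For a nonzero first component the shift moves every basis vector and the diagonal
  vanishes; otherwise the trace is a geometric sum over powers of a root of unity.\<close>

lemma Dq_trace:
  assumes "fst a < L" "snd a < L"
  shows "(\<Sum>c<L. Dq L a c c) = (if a = (0, 0) then of_nat L else 0)"
proof (cases "fst a = 0")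
  case True
  then have "(\<Sum>c<L. Dq L a c c) = (\<Sum>c<L. omega L ^ (snd a * c))"
    by (intro sum.cong) (auto simp: Dq_def)
  also have "\<dots> = (if a = (0, 0) then of_nat L else 0)"
    using assms True by (cases a) (auto simp: sum_omega dest: nat_dvd_not_less)
  finally show ?thesis .
next
  case False
  have ne: "(c + fst a) mod L \<noteq> c" if "c < L" for c
    using add_mod_cancel[of 0 L "fst a" c] False assms that by (simp add: add.commute)
  then have "Dq L a c c = 0" if "c < L" for c
    using ne[OF that] by (simp add: Dq_def eq_commute[of c])
  then show ?thesis using False by auto
qed

text \<open>Up to a phase the square is the displacement with doubled components, which is traceless
  unless both vanish mod L. Taking the modulus disposes of all powers of \<open>tau\<close>.\<close>

lemma Dq_trace_square:
  assumes "L > 0"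
  shows "cmod (\<Sum>c<L. \<Sum>r<L. Dq L a c r * Dq L a r c) = (if L dvd 2 * fst a \<and> L dvd 2 * snd a then real L else 0)"
proof -
  let ?t = "tau L ^ (fst a * snd a)"
  have 1: "(\<Sum>r<L. Dq L a c r * Dq L a r c) =
      (if L dvd 2 * fst a then ?t * ?t * omega L ^ (snd a * fst a) * omega L ^ (2 * snd a * c) else 0)"
    if c: "c < L" for c
  proof -
    let ?r = "(c + fst a) mod L"
    have "(\<Sum>r<L. Dq L a c r * Dq L a r c) = (\<Sum>r<L. if r = ?r then Dq L a c ?r * Dq L a ?r c else 0)"
      by (intro sum.cong) (auto simp: Dq_def)
    also have "\<dots> = Dq L a c ?r * Dq L a ?r c" using assms by simp
    also have "\<dots> = (if c = (?r + fst a) mod L then ?t * ?t * (omega L ^ (snd a * ?r) * omega L ^ (snd a * c)) else 0)"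
      by (simp add: Dq_def)
    also have "c = (?r + fst a) mod L \<longleftrightarrow> L dvd 2 * fst a"
    proof -
      have "(?r + fst a) mod L = (2 * fst a + c) mod L" by (simp add: mod_add_left_eq) (simp add: mult_2 add_ac)
      moreover have "(2 * fst a + c) mod L = c \<longleftrightarrow> L dvd 2 * fst a"
        using c mod_eq_dvd_iff_nat[of c "2 * fst a + c" L] by simp
      ultimately show ?thesis by auto
    qed
    \<comment> \<open>Exponents of \<open>omega L\<close> count only mod L, so the reduced index may
      be replaced by \<open>c + fst a\<close>.\<close>
    also have "omega L ^ (snd a * ?r) * omega L ^ (snd a * c) = omega L ^ (snd a * fst a) * omega L ^ (2 * snd a * c)"
    proof -
      have "omega L ^ (snd a * (c + fst a)) = omega L ^ (snd a * (?r + L * ((c + fst a) div L)))" by simp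
      also have "\<dots> = omega L ^ (snd a * ?r) * (omega L ^ L) ^ (snd a * ((c + fst a) div L))"
        by (simp only: distrib_left power_add power_mult[symmetric] mult.left_commute)
      also have "omega L ^ L = 1" using assms by (simp add: omega_power_eq_1)
      finally have "omega L ^ (snd a * ?r) = omega L ^ (snd a * (c + fst a))" by simp
      moreover have "snd a * (c + fst a) + snd a * c = snd a * fst a + 2 * snd a * c" by algebra
      ultimately show ?thesis by (metis power_add)
    qed
    finally show ?thesis by (simp add: mult.assoc)
  qed
  show ?thesis
  proof (cases "L dvd 2 * fst a")
    case True
    then have "(\<Sum>c<L. \<Sum>r<L. Dq L a c r * Dq L a r c) =
        ?t * ?t * omega L ^ (snd a * fst a) * (\<Sum>c<L. omega L ^ (2 * snd a * c))"
      by (simp add: 1 sum_distrib_left)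
    then show ?thesis using True by (simp add: norm_mult norm_power sum_omega[OF assms])
  qed (simp add: 1)
qed

lemma card_half_multiples:
  assumes "(L::nat) > 0"
  shows "card {a\<in>{..<L}. L dvd 2 * a} = (if even L then 2 else 1)"
proof (cases "even L")
  case True
  then obtain h where h: "L = 2 * h" by (elim evenE)
  have "{a\<in>{..<L}. L dvd 2 * a} = {0, h}"
  proof
    show "{a\<in>{..<L}. L dvd 2 * a} \<subseteq> {0, h}"
    proof
      fix a assume "a \<in> {a\<in>{..<L}. L dvd 2 * a}"
      then have "a < 2 * h" "h dvd a" by (auto simp: h)
      then obtain k where "a = h * k" "k < 2" using assms h by (auto simp: dvd_def mult.commute)
      then show "a \<in> {0, h}" by (auto simp: less_2_cases_iff)
    qed
  qed (use assms h in auto)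
  then show ?thesis using True assms h by simp
next
  case False
  have "L dvd 2 * a \<longleftrightarrow> L dvd a" for a using False by (simp add: coprime_dvd_mult_right_iff)
  then have "{a\<in>{..<L}. L dvd 2 * a} = {0}" using assms by (auto dest: nat_dvd_not_less)
  then show ?thesis using False by simp
qed

lemma sum_Dq_trace_square:
  assumes "L > 0"
  shows "(\<Sum>a\<in>{..<L}\<times>{..<L}. (cmod (\<Sum>c<L. \<Sum>r<L. Dq L a c r * Dq L a r c))\<^sup>2) =
    (if even L then 4 else 1) * (real L)\<^sup>2"
proof -
  let ?H = "{a\<in>{..<L}. L dvd 2 * a}"
  have "(\<Sum>a\<in>{..<L}\<times>{..<L}. (cmod (\<Sum>c<L. \<Sum>r<L. Dq L a c r * Dq L a r c))\<^sup>2) =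
     (\<Sum>a\<in>{..<L}\<times>{..<L}. if a \<in> ?H \<times> ?H then (real L)\<^sup>2 else 0)"
    by (intro sum.cong) (auto simp: Dq_trace_square[OF assms])
  also have "\<dots> = (\<Sum>a\<in>?H \<times> ?H. (real L)\<^sup>2)"
    by (rule sum.mono_neutral_cong_right) auto
  also have "\<dots> = (if even L then 4 else 1) * (real L)\<^sup>2"
    by (simp only: sum_constant card_cartesian_product card_half_multiples[OF assms]) simp
  finally show ?thesis .
qed

section \<open>Displacement operators on n qudits\<close>

lemma Dmat_entry:
  "r < L ^ n \<Longrightarrow> c < L ^ n \<Longrightarrow> Dmat L n a (r, c) = (\<Prod>j<n. Dq L (a j) (digit L j r) (digit L j c))"
  by (simp add: Dmat_def idx_def)

lemma Dmat_unitary: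
  assumes "L > 0"
  shows "is_unitary (L ^ n) (entries (Dmat L n a))"
  unfolding is_unitary_def
proof (intro allI impI)
  fix c c' assume c: "c < L ^ n" "c' < L ^ n"
  have "(\<Sum>r<L ^ n. cnj (Dmat L n a (r, c)) * Dmat L n a (r, c')) =
     (\<Sum>r<L ^ n. \<Prod>j<n. cnj (Dq L (a j) (digit L j r) (digit L j c)) * Dq L (a j) (digit L j r) (digit L j c'))"
    using c by (intro sum.cong) (auto simp: Dmat_entry prod.distrib)
  also have "\<dots> = (\<Prod>j<n. \<Sum>r<L. cnj (Dq L (a j) r (digit L j c)) * Dq L (a j) r (digit L j c'))"
    by (rule sum_digits[OF assms])
  also have "\<dots> = delta c c'" using c by (simp add: Dq_unitary digit_less[OF assms] delta_digits)
  finally show "(\<Sum>r<L ^ n. cnj (Dmat L n a (r, c)) * Dmat L n a (r, c')) = delta c c'" .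
qed

lemma tr1_Dmat:
  assumes "L > 0"
  shows "tr1 (L ^ n) (entries (Dmat L n a)) = (\<Prod>j<n. \<Sum>c<L. Dq L (a j) c c)"
  unfolding tr1_def sum_digits[OF assms, symmetric]
  by (intro sum.cong) (auto simp: Dmat_entry)

lemma tr2_Dmat:
  assumes "L > 0"
  shows "tr2 (L ^ n) (entries (Dmat L n a)) (entries (Dmat L n a)) =
    (\<Prod>j<n. \<Sum>c<L. \<Sum>r<L. Dq L (a j) c r * Dq L (a j) r c)"
proof -
  have "tr2 (L ^ n) (entries (Dmat L n a)) (entries (Dmat L n a)) =
    (\<Sum>c<L ^ n. \<Sum>r<L ^ n. \<Prod>j<n. Dq L (a j) (digit L j c) (digit L j r) * Dq L (a j) (digit L j r) (digit L j c))"
    unfolding tr2_def by (intro sum.cong) (auto simp: Dmat_entry prod.distrib)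
  also have "\<dots> = (\<Sum>c<L ^ n. \<Prod>j<n. \<Sum>r<L. Dq L (a j) (digit L j c) r * Dq L (a j) r (digit L j c))"
    by (intro sum.cong refl sum_digits[OF assms])
  also have "\<dots> = (\<Prod>j<n. \<Sum>c<L. \<Sum>r<L. Dq L (a j) c r * Dq L (a j) r c)"
    by (rule sum_digits[OF assms])
  finally show ?thesis .
qed

text \<open>The zero phase point, extensional so as to lie in \<open>phase_points\<close>. Its
  operator is the identity, the only displacement operator with nonzero trace.\<close>

definition origin :: "nat \<Rightarrow> nat \<Rightarrow> nat \<times> nat" where
  "origin n = restrict (\<lambda>_. (0, 0)) {..<n}"

lemma origin_in: "L > 0 \<Longrightarrow> origin n \<in> phase_points L n"
  by (auto simp: origin_def phase_points_def)

lemma finite_phase_points [simp]: "finite (phase_points L n)"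
  unfolding phase_points_def by (intro finite_PiE) auto

lemma card_phase_points: "card (phase_points L n) = (L ^ n)\<^sup>2"
  by (simp add: phase_points_def card_PiE card_cartesian_product power2_eq_square power_mult_distrib)

lemma tr1_Dmat_zero:
  assumes L: "L > 0" and a: "a \<in> phase_points L n" "a \<noteq> origin n"
  shows "tr1 (L ^ n) (entries (Dmat L n a)) = 0"
proof -
  have "\<exists>j<n. a j \<noteq> (0, 0)"
  proof (rule ccontr)
    assume "\<not> ?thesis"
    then have "a = origin n" using a(1) by (auto simp: phase_points_def origin_def PiE_def extensional_def)
    then show False using a(2) by simp
  qed
  then obtain j where j: "j < n" "a j \<noteq> (0, 0)" by blast
  have "a j \<in> {..<L} \<times> {..<L}" using a(1) j(1) by (auto simp: phase_points_def PiE_def)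
  then have "(\<Sum>c<L. Dq L (a j) c c) = 0" using j by (subst Dq_trace) auto
  then show ?thesis unfolding tr1_Dmat[OF L] using j(1) by (auto intro!: prod_zero)
qed

lemma Dmat_origin:
  assumes "L > 0" "r < L ^ n" "c < L ^ n"
  shows "Dmat L n (origin n) (r, c) = delta r c"
proof -
  have "Dmat L n (origin n) (r, c) = (\<Prod>j<n. delta (digit L j r) (digit L j c))"
    unfolding Dmat_entry[OF assms(2,3)]
    by (intro prod.cong) (auto simp: Dq_def origin_def delta_def digit_less[OF assms(1)])
  then show ?thesis by (simp add: delta_digits assms)
qed

lemma sum_tr2_Dmat:
  assumes "L > 0"
  shows "(\<Sum>a\<in>phase_points L n. (cmod (tr2 (L ^ n) (entries (Dmat L n a)) (entries (Dmat L n a))))\<^sup>2) =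
    (if even L then 4 else 1) ^ n * (real (L ^ n))\<^sup>2"
proof -
  have "(\<Sum>a\<in>phase_points L n. (cmod (tr2 (L ^ n) (entries (Dmat L n a)) (entries (Dmat L n a))))\<^sup>2) =
     (\<Sum>a\<in>phase_points L n. \<Prod>j<n. (cmod (\<Sum>c<L. \<Sum>r<L. Dq L (a j) c r * Dq L (a j) r c))\<^sup>2)"
    unfolding tr2_Dmat[OF assms] by (simp add: prod_norm[symmetric] prod_power_distrib)
  also have "\<dots> = (\<Prod>j<n. \<Sum>a\<in>{..<L}\<times>{..<L}. (cmod (\<Sum>c<L. \<Sum>r<L. Dq L a c r * Dq L a r c))\<^sup>2)"
    unfolding phase_points_def by (rule prod_sum_PiE[symmetric]) auto
  also have "\<dots> = (if even L then 4 else 1) ^ n * (real (L ^ n))\<^sup>2"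
    unfolding sum_Dq_trace_square[OF assms] by (simp add: power_mult_distrib power_mult[symmetric] mult.commute)
  finally show ?thesis .
qed

section \<open>The expected entropy\<close>

lemma mtrace_tr2:
  "mtrace d (mmul d (mmul d (adj d A) U) (mmul d B (adj d U))) =
    tr2 d (madj (entries A)) (conjugated d (entries U) (entries B))"
proof -
  have "mtrace d (mmul d (mmul d (adj d A) U) (mmul d B (adj d U))) =
      tr1 d (mprod d (mprod d (madj (entries A)) (entries U)) (mprod d (entries B) (madj (entries U))))"
    unfolding mtrace_def tr1_def
  proof (intro sum.cong refl)
    fix i assume i: "i \<in> {..<d}"
    have "mmul d (adj d A) U (i, k) = mprod d (madj (entries A)) (entries U) i k"
      "mmul d B (adj d U) (k, i) = mprod d (entries B) (madj (entries U)) k i" if "k < d" for k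
      using i that by (auto simp: entries_mmul entries_adj intro!: mprod_cong)
    then show "mmul d (mmul d (adj d A) U) (mmul d B (adj d U)) (i, i) =
       mprod d (mprod d (madj (entries A)) (entries U)) (mprod d (entries B) (madj (entries U))) i i"
      using i by (subst entries_mmul) (auto intro!: mprod_cong)
  qed
  then show ?thesis by (simp add: conjugated_def mprod_assoc flip: tr1_mprod)
qed

lemma tr2_cong:
  "(\<And>i j. i < d \<Longrightarrow> j < d \<Longrightarrow> A i j = A' i j) \<Longrightarrow> (\<And>i j. i < d \<Longrightarrow> j < d \<Longrightarrow> B i j = B' i j) \<Longrightarrow>
   tr2 d A B = tr2 d A' B'"
  unfolding tr2_def by (intro sum.cong refl) auto

lemma tr2_delta: "tr2 d delta B = tr1 d B" "tr2 d B delta = tr1 d B"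
  unfolding tr2_def tr1_def by (simp_all add: sum_delta_left sum_delta_right)

lemma tr1_delta: "tr1 d delta = of_nat d"
  by (simp add: tr1_def delta_def)

text \<open>If either operator is the identity, \<open>U\<close> cancels against its adjoint and the
  trace is that of the other operator: \<open>L ^ n\<close> when both are the identity, and 0
  otherwise.\<close>

lemma haar_fourth_moment_origin:
  assumes H: "haar_measure (L ^ n) M" and L: "L > 0"
    and a: "a \<in> phase_points L n" and b: "b \<in> phase_points L n" and o: "a = origin n \<or> b = origin n"
  shows "(\<integral>U. cmod (tr2 (L ^ n) (madj (entries (Dmat L n a))) (conjugated (L ^ n) (entries U) (entries (Dmat L n b)))) ^ 4 \<partial>M)
    = (if a = origin n \<and> b = origin n then real (L ^ n) ^ 4 else 0)"
proof -
  interpret prob_space M using haar_prob_space[OF H] .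
  let ?d = "L ^ n"
  let ?A = "entries (Dmat L n a)" and ?B = "entries (Dmat L n b)"
  have del: "entries (Dmat L n (origin n)) i j = delta i j" if "i < ?d" "j < ?d" for i j
    using Dmat_origin[OF L that] .
  have t1: "tr1 ?d (entries (Dmat L n c)) = (if c = origin n then of_nat ?d else 0)" if "c \<in> phase_points L n" for c
  proof (cases "c = origin n")
    case True
    then show ?thesis using del by (simp add: tr1_def delta_def)
  next
    case False
    then show ?thesis using tr1_Dmat_zero[OF L that] by simp
  qed
  have "tr2 ?d (madj ?A) (conjugated ?d (entries U) ?B) =
      (if a = origin n \<and> b = origin n then of_nat ?d else 0)" if U: "is_unitary ?d (entries U)" for U
  proof (cases "a = origin n")
    case True
    have "tr2 ?d (madj ?A) (conjugated ?d (entries U) ?B) = tr2 ?d delta (conjugated ?d (entries U) ?B)"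
      using del True by (intro tr2_cong refl) (auto simp: madj_def delta_def)
    then show ?thesis using True t1[OF b] by (simp add: tr2_delta tr1_conjugated[OF U])
  next
    case False
    then have b': "b = origin n" using o by simp
    have "tr2 ?d (madj ?A) (conjugated ?d (entries U) ?B) = tr2 ?d (madj ?A) delta"
    proof (intro tr2_cong refl)
      fix i j assume ij: "i < ?d" "j < ?d"
      have "conjugated ?d (entries U) ?B i j = mprod ?d (mprod ?d (entries U) delta) (madj (entries U)) i j"
        unfolding conjugated_def using del b' by (intro mprod_cong refl) auto
      also have "\<dots> = mprod ?d (entries U) (madj (entries U)) i j"
        by (intro mprod_cong refl) (simp add: mprod_delta_right)
      finally show "conjugated ?d (entries U) ?B i j = delta i j" using is_unitary_right[OF U ij] by simp
    qed
    then show ?thesis using False t1[OF a] by (simp add: tr2_delta tr1_madj)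
  qed
  note eq = this
  have "(\<integral>U. cmod (tr2 ?d (madj ?A) (conjugated ?d (entries U) ?B)) ^ 4 \<partial>M) =
      (\<integral>U. (if a = origin n \<and> b = origin n then real ?d ^ 4 else 0) \<partial>M)"
  proof (rule integral_cong_AE)
    show "AE U in M. cmod (tr2 ?d (madj ?A) (conjugated ?d (entries U) ?B)) ^ 4 =
        (if a = origin n \<and> b = origin n then real ?d ^ 4 else 0)"
      using haar_AE[OF H] by eventually_elim (simp add: eq norm_power)
  qed (use integrable_trace_power_four[OF H] in auto)
  then show ?thesis by (simp add: prob_space)
qed

text \<open>\<open>c0\<close> and \<open>c1\<close> are the coefficients found in
  \<open>weingarten_traceless_sum\<close>. The term \<open>D ^ 4\<close> comes from both points
  being the origin; pairs with exactly one origin contribute 0. Over the remaining pairs the moment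
  is a polynomial in \<open>x a\<close> and \<open>x b\<close>, so only the number of points and the
  sum of \<open>x\<close> enter.\<close>

lemma expected_H2:
  assumes H: "haar_measure (L ^ n) M" and L: "L > 0"
    and W: "gram_inverse (L ^ n) (class_fun wI wT wD w3 w4)"
  defines "D \<equiv> real (L ^ n)" and "\<kappa> \<equiv> (if even L then 4 else 1) ^ n"
  defines "c0 \<equiv> 6 * D\<^sup>2 * (wI + wD + 4 * w3) + 2 * D ^ 4 * (wI + wD) + 2 * D ^ 3 * (4 * w4 + 8 * wT)"
    and "c1 \<equiv> 2 * D\<^sup>2 * wD + D * (2 * w4 + 4 * wT)"
  shows "(\<integral>U. H2 L n U \<partial>M) = 1 - (D ^ 4 + c0 * (D\<^sup>2 - 1)\<^sup>2 +
    2 * c1 * (D\<^sup>2 - 1) * ((\<kappa> - 1) * D\<^sup>2) + wI * ((\<kappa> - 1) * D\<^sup>2)\<^sup>2) / D ^ 6"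
proof -
  interpret prob_space M using haar_prob_space[OF H] .
  let ?d = "L ^ n" and ?P = "phase_points L n"
  let ?P' = "?P - {origin n}"
  let ?D = "\<lambda>a. entries (Dmat L n a)"
  let ?z = "\<lambda>a b U. cmod (tr2 ?d (madj (?D a)) (conjugated ?d (entries U) (?D b))) ^ 4"
  define x where "x a = (cmod (tr2 ?d (?D a) (?D a)))\<^sup>2" for a
  define E where "E a b = (\<integral>U. ?z a b U \<partial>M)" for a b
  have Eo: "E a b = (if a = origin n \<and> b = origin n then D ^ 4 else 0)"
    if "a \<in> ?P" "b \<in> ?P" "a = origin n \<or> b = origin n" for a b
    unfolding E_def D_def by (rule haar_fourth_moment_origin[OF H L that])
  have E: "E a b = c0 + c1 * (x a + x b) + wI * x a * x b" if "a \<in> ?P'" "b \<in> ?P'" for a b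
  proof -
    have "E a b = (\<Sum>s\<in>S4. \<Sum>p\<in>S4. class_fun wI wT wD w3 w4 s * traceless_val ?d (x b) p *
       traceless_val ?d ((cmod (tr2 ?d (madj (?D a)) (madj (?D a))))\<^sup>2) (act s p))"
      unfolding E_def x_def using that
      by (intro haar_fourth_moment[OF H _ _ _ _ W] is_unitary_madj Dmat_unitary[OF L])
         (auto simp: tr1_madj tr1_Dmat_zero[OF L])
    then show ?thesis
      unfolding weingarten_traceless_sum tr2_madj
      by (simp add: x_def c0_def c1_def D_def)
  qed
  have o: "origin n \<in> ?P" by (rule origin_in[OF L])
  have xo: "x (origin n) = D\<^sup>2"
  proof -
    have "tr2 ?d (?D (origin n)) (?D (origin n)) = tr2 ?d delta delta"
      using Dmat_origin[OF L] by (intro tr2_cong) auto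
    then show ?thesis by (simp add: x_def tr2_delta tr1_delta D_def norm_power)
  qed
  have card': "real (card ?P') = D\<^sup>2 - 1"
    using o by (simp add: card_phase_points D_def of_nat_diff Suc_leI card_Diff_singleton L)
  \<comment> \<open>The full sum is \<kappa> D^2, and the origin accounts for one D^2 of it.\<close>
  have xsum: "(\<Sum>a\<in>?P'. x a) = (\<kappa> - 1) * D\<^sup>2"
    using sum_tr2_Dmat[OF L, of n] sum.remove[OF finite_phase_points o, of x] xo
    by (simp add: x_def[symmetric] D_def \<kappa>_def algebra_simps)
  have "(\<Sum>a\<in>?P. \<Sum>b\<in>?P. E a b) = D ^ 4 + (\<Sum>a\<in>?P'. \<Sum>b\<in>?P'. E a b)"
  proof -
    have "(\<Sum>b\<in>?P. E a b) = (\<Sum>b\<in>?P'. E a b)" if "a \<in> ?P'" for a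
      using that o by (subst sum.remove[OF finite_phase_points o]) (simp add: Eo)
    moreover have "(\<Sum>b\<in>?P. E (origin n) b) = D ^ 4"
      using o by (subst sum.remove[OF finite_phase_points o]) (simp add: Eo)
    ultimately show ?thesis by (subst sum.remove[OF finite_phase_points o]) simp
  qed
  also have "(\<Sum>a\<in>?P'. \<Sum>b\<in>?P'. E a b) = (\<Sum>a\<in>?P'. \<Sum>b\<in>?P'. c0 + c1 * x a + c1 * x b + wI * x a * x b)"
    by (intro sum.cong refl) (simp add: E algebra_simps)
  also have "\<dots> = c0 * (D\<^sup>2 - 1)\<^sup>2 + 2 * c1 * (D\<^sup>2 - 1) * ((\<kappa> - 1) * D\<^sup>2) + wI * ((\<kappa> - 1) * D\<^sup>2)\<^sup>2"
  proof -
    have inner: "(\<Sum>b\<in>?P'. c0 + c1 * x a + c1 * x b + wI * x a * x b) =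
        (D\<^sup>2 - 1) * (c0 + c1 * x a) + c1 * ((\<kappa> - 1) * D\<^sup>2) + wI * x a * ((\<kappa> - 1) * D\<^sup>2)" for a
      by (simp only: sum.distrib sum_constant card' xsum flip: sum_distrib_left)
         (simp add: algebra_simps)
    have "(\<Sum>a\<in>?P'. \<Sum>b\<in>?P'. c0 + c1 * x a + c1 * x b + wI * x a * x b) =
      (\<Sum>a\<in>?P'. ((D\<^sup>2 - 1) * c0 + c1 * ((\<kappa> - 1) * D\<^sup>2)) + ((D\<^sup>2 - 1) * c1 + wI * ((\<kappa> - 1) * D\<^sup>2)) * x a)"
      by (simp only: inner) (simp add: algebra_simps)
    also have "\<dots> = (D\<^sup>2 - 1) * ((D\<^sup>2 - 1) * c0 + c1 * ((\<kappa> - 1) * D\<^sup>2)) + ((D\<^sup>2 - 1) * c1 + wI * ((\<kappa> - 1) * D\<^sup>2)) * ((\<kappa> - 1) * D\<^sup>2)"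
      by (simp only: sum.distrib sum_constant card' xsum distrib_left flip: sum_distrib_left)
    finally show ?thesis by (simp add: algebra_simps power2_eq_square)
  qed
  finally have tot: "(\<Sum>a\<in>?P. \<Sum>b\<in>?P. E a b) = D ^ 4 + c0 * (D\<^sup>2 - 1)\<^sup>2 +
    2 * c1 * (D\<^sup>2 - 1) * ((\<kappa> - 1) * D\<^sup>2) + wI * ((\<kappa> - 1) * D\<^sup>2)\<^sup>2" by simp
  have int: "integrable M (?z a b)" for a b by (rule integrable_trace_power_four[OF H])
  have "(\<integral>U. H2 L n U \<partial>M) = (\<integral>U. 1 - (1 / D ^ 6) * (\<Sum>a\<in>?P. \<Sum>b\<in>?P. ?z a b U) \<partial>M)"
    unfolding H2_def Let_def mtrace_tr2 D_def ..
  also have "\<dots> = 1 - (1 / D ^ 6) * (\<Sum>a\<in>?P. \<Sum>b\<in>?P. E a b)"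
    unfolding E_def
    by (subst Bochner_Integration.integral_diff) (auto simp: int prob_space)
  finally show ?thesis unfolding tot by simp
qed

lemma expected_H2_ge_4:
  assumes H: "haar_measure (L ^ n) M" and L: "L ^ n \<ge> 4"
  defines "D \<equiv> real (L ^ n)" and "\<kappa> \<equiv> (if even L then 4 else 1) ^ n"
  shows "(\<integral>U. H2 L n U \<partial>M) = 1 - (D ^ 4 + 2 * D\<^sup>2 * (D\<^sup>2 - 3) * (D\<^sup>2 - 1) / (D\<^sup>2 - 4)
    - 4 * (\<kappa> - 1) * D\<^sup>2 / (D\<^sup>2 - 4)
    + (\<kappa> - 1)\<^sup>2 * D\<^sup>2 * (D ^ 4 - 8 * D\<^sup>2 + 6) / ((D\<^sup>2 - 1) * (D\<^sup>2 - 4) * (D\<^sup>2 - 9))) / D ^ 6"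
proof -
  have L0: "L > 0" using L by (cases "L = 0") (auto simp: power_0_left split: if_splits)
  \<comment> \<open>\<open>wT\<close> and \<open>w4\<close> are odd in \<open>D\<close> but occur
    only next to odd powers of \<open>D\<close>, so everything is a rational function of
    \<open>e\<close>.\<close>
  define e where "e = D\<^sup>2"
  have "real 4 \<le> D" unfolding D_def using L by (simp only: of_nat_le_iff)
  then have "(4::real)\<^sup>2 \<le> D\<^sup>2" by (intro power_mono) auto
  then have e: "e \<ge> 16" by (simp add: e_def)
  define m where "m = e * (e - 1) * (e - 4) * (e - 9)"
  define wI where "wI = (D ^ 4 - 8 * D\<^sup>2 + 6) / m"
  define wT where "wT = - D * (D\<^sup>2 - 4) / m"
  define wD where "wD = (D\<^sup>2 + 6) / m"
  define w3 where "w3 = (2 * D\<^sup>2 - 3) / m"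
  define w4 where "w4 = - 5 * D / m"
  have W: "gram_inverse (L ^ n) (class_fun wI wT wD w3 w4)"
    using gram_inverse_ge_4[OF L] unfolding D_def[symmetric] wI_def wT_def wD_def w3_def w4_def m_def e_def .
  have D4: "D ^ 4 = e * e" and D3: "D ^ 3 = e * D" and DD: "D * D = e"
    by (simp_all add: e_def power2_eq_square power3_eq_cube power4_eq_xxxx)
  \<comment> \<open>Here and in \<open>c1\<close> the numerator contains e (e - 9), which cancels
    against \<open>m\<close>. Only the term with \<open>wI\<close>, weighted by (\<kappa> - 1)^2,
    keeps the factor e - 9 in the denominator.\<close>
  have c0: "6 * D\<^sup>2 * (wI + wD + 4 * w3) + 2 * D ^ 4 * (wI + wD) + 2 * D ^ 3 * (4 * w4 + 8 * wT) =
      2 * e * (e - 3) / ((e - 1) * (e - 4))"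
  proof -
    have "6 * D\<^sup>2 * (wI + wD + 4 * w3) + 2 * D ^ 4 * (wI + wD) + 2 * D ^ 3 * (4 * w4 + 8 * wT) =
       (6 * e * ((e * e - 8 * e + 6) + (e + 6) + 4 * (2 * e - 3)) + 2 * (e * e) * ((e * e - 8 * e + 6) + (e + 6))
         + 2 * e * (- 20 * (D * D) - 8 * (D * D) * (e - 4))) / m"
      unfolding wI_def wT_def wD_def w3_def w4_def D4 D3 e_def[symmetric]
      by (simp add: add_divide_distrib diff_divide_distrib algebra_simps)
    also have "\<dots> = (2 * e * (e - 3) * (e * (e - 9))) / m"
      unfolding DD by (simp add: algebra_simps)
    also have "\<dots> = 2 * e * (e - 3) / ((e - 1) * (e - 4))"
      using e by (simp add: m_def frac_eq_eq)
    finally show ?thesis .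
  qed
  have c1: "2 * D\<^sup>2 * wD + D * (2 * w4 + 4 * wT) = - 2 / ((e - 1) * (e - 4))"
  proof -
    have "2 * D\<^sup>2 * wD + D * (2 * w4 + 4 * wT) = (2 * e * (e + 6) - 10 * (D * D) - 4 * (D * D) * (e - 4)) / m"
      unfolding wT_def wD_def w4_def e_def[symmetric]
      by (simp add: add_divide_distrib diff_divide_distrib algebra_simps)
    also have "\<dots> = (- 2 * (e * (e - 9))) / m" unfolding DD by (simp add: algebra_simps)
    also have "\<dots> = - 2 / ((e - 1) * (e - 4))"
      using e by (simp add: m_def frac_eq_eq)
    finally show ?thesis .
  qed
  have "(\<integral>U. H2 L n U \<partial>M) = 1 - (D ^ 4 + 2 * e * (e - 3) / ((e - 1) * (e - 4)) * (e - 1)\<^sup>2 +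
    2 * (- 2 / ((e - 1) * (e - 4))) * (e - 1) * ((\<kappa> - 1) * e) + wI * ((\<kappa> - 1) * e)\<^sup>2) / D ^ 6"
    using expected_H2[OF H L0 W] unfolding D_def[symmetric] \<kappa>_def[symmetric]
    unfolding c0 c1 unfolding e_def[symmetric] .
  also have "2 * e * (e - 3) / ((e - 1) * (e - 4)) * (e - 1)\<^sup>2 = 2 * e * (e - 3) * (e - 1) / (e - 4)"
    using e by (simp add: power2_eq_square)
  also have "2 * (- 2 / ((e - 1) * (e - 4))) * (e - 1) * ((\<kappa> - 1) * e) = - (4 * (\<kappa> - 1) * e / (e - 4))"
  proof -
    have "2 * (- 2 / p) * a * x = - 4 * x * (a / p)" for p a x :: real by simp
    then have "2 * (- 2 / ((e - 1) * (e - 4))) * (e - 1) * ((\<kappa> - 1) * e) =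
        - 4 * ((\<kappa> - 1) * e) * ((e - 1) / ((e - 1) * (e - 4)))" .
    also have "(e - 1) / ((e - 1) * (e - 4)) = 1 / (e - 4)" using e by simp
    finally show ?thesis by simp
  qed
  also have "wI * ((\<kappa> - 1) * e)\<^sup>2 = (\<kappa> - 1)\<^sup>2 * e * (D ^ 4 - 8 * e + 6) / ((e - 1) * (e - 4) * (e - 9))"
    using e by (simp add: wI_def m_def e_def[symmetric] power_mult_distrib power2_eq_square[of e] mult_ac)
  finally show ?thesis unfolding e_def by simp
qed

section \<open>The three closed formulas\<close>

lemma expected_H2_odd:
  assumes H: "haar_measure d M" and d: "odd d"
  shows "(\<integral>U. H2 d 1 U \<partial>M) =
    1 - 3 * (real d ^ 4 - 4 * real d ^ 2 + 2) / (real d ^ 4 * (real d ^ 2 - 4))"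
proof -
  have H1: "haar_measure (d ^ 1) M" using H by simp
  consider "d = 1" | "d = 3" | "d \<ge> 4"
  proof -
    have "d = 1 \<or> d = 3 \<or> d \<ge> 4" using d by (cases "d = 0"; cases "d = 2") auto
    then show ?thesis using that by blast
  qed
  then show ?thesis
  proof cases
    case 1
    have "gram_inverse (d ^ 1) (class_fun (1/24) 0 0 0 0)" using gram_inverse_1 1 by simp
    from expected_H2[OF H1 _ this] show ?thesis using 1 by simp
  next
    case 2
    have "gram_inverse (d ^ 1) (class_fun (61/2880) (-7/1728) (-11/2880) (-1/960) (37/8640))"
      using gram_inverse_3 2 by simp
    from expected_H2[OF H1 _ this] show ?thesis using 2 by simp
  next
    case 3
    define e where "e = (real d)\<^sup>2"
    have "(4::real)\<^sup>2 \<le> (real d)\<^sup>2" using 3 by (intro power_mono) auto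
    then have e: "e \<ge> 16" by (simp add: e_def)
    have D: "real d ^ 4 = e * e" "real d ^ 6 = e * e * e" by (simp_all add: e_def flip: power_add)
    have "(\<integral>U. H2 d 1 U \<partial>M) = 1 - (e * e + 2 * e * (e - 3) * (e - 1) / (e - 4)) / (e * e * e)"
      \<comment> \<open>For odd \<open>d\<close> the parameter \<kappa> is 1, and all terms
        involving traces of squares drop out.\<close>
      using expected_H2_ge_4[OF H1] 3 d by (simp add: D flip: e_def)
    also have "\<dots> = 1 - 3 * (e * e - 4 * e + 2) / (e * e * (e - 4))"
      using e by (simp add: divide_simps) (simp add: algebra_simps)
    finally show ?thesis by (simp add: D flip: e_def)
  qed
qed

lemma expected_H2_even:
  assumes H: "haar_measure d M" and d: "even d" "d > 0"
  shows "(\<integral>U. H2 d 1 U \<partial>M) =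
    1 - 3 * (real d ^ 4 - 10 * real d ^ 2 + 10) / (real d ^ 2 * (real d ^ 2 - 9) * (real d ^ 2 - 1))"
proof -
  have H1: "haar_measure (d ^ 1) M" using H by simp
  consider "d = 2" | "d \<ge> 4"
  proof -
    have "d = 2 \<or> d \<ge> 4" using d by (cases "d = 1"; cases "d = 3") auto
    then show ?thesis using that by blast
  qed
  then show ?thesis
  proof cases
    case 1
    have "gram_inverse (d ^ 1) (class_fun (43/1440) (1/180) (13/1440) (-19/2880) (-7/1440))"
      using gram_inverse_2 1 by simp
    from expected_H2[OF H1 _ this] show ?thesis using 1 by simp
  next
    case 2
    define e where "e = (real d)\<^sup>2"
    have "(4::real)\<^sup>2 \<le> (real d)\<^sup>2" using 2 by (intro power_mono) auto
    then have e: "e \<ge> 16" by (simp add: e_def)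
    have D: "real d ^ 4 = e * e" "real d ^ 6 = e * e * e" by (simp_all add: e_def flip: power_add)
    \<comment> \<open>Here \<kappa> = 4; the constants 12 and 9 are 4 (\<kappa> - 1) and (\<kappa> -
      1)^2.\<close>
    have "(\<integral>U. H2 d 1 U \<partial>M) = 1 - (e * e + 2 * e * (e - 3) * (e - 1) / (e - 4) - 12 * e / (e - 4)
        + 9 * e * (e * e - 8 * e + 6) / ((e - 1) * (e - 4) * (e - 9))) / (e * e * e)"
      using expected_H2_ge_4[OF H1] 2 d by (simp add: D flip: e_def)
    also have "\<dots> = 1 - 3 * (e * e - 10 * e + 10) / (e * (e - 9) * (e - 1))"
      using e by (simp add: divide_simps) (simp add: algebra_simps)
    finally show ?thesis by (simp add: D flip: e_def)
  qed
qed

lemma expected_H2_qubits: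
  assumes H: "haar_measure (2 ^ n) M"
  shows "(\<integral>U. H2 2 n U \<partial>M) =
    1 - 4 * (real (2 ^ n) ^ 4 - 9 * real (2 ^ n) ^ 2 + 6) / (real (2 ^ n) ^ 4 * (real (2 ^ n) ^ 2 - 9))"
proof -
  consider "n = 0" | "n = 1" | k where "n = Suc (Suc k)" by (metis One_nat_def not0_implies_Suc)
  then show ?thesis
  proof cases
    case 1
    have "gram_inverse (2 ^ n) (class_fun (1/24) 0 0 0 0)" using gram_inverse_1 1 by simp
    from expected_H2[OF H _ this] show ?thesis using 1 by simp
  next
    case 2
    have "gram_inverse (2 ^ n) (class_fun (43/1440) (1/180) (13/1440) (-19/2880) (-7/1440))"
      using gram_inverse_2 2 by simp
    from expected_H2[OF H _ this] show ?thesis using 2 by simp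
  next
    case 3
    have d: "(2::nat) ^ n \<ge> 4" by (simp add: 3)
    define e where "e = (real (2 ^ n))\<^sup>2"
    have "(4::real)\<^sup>2 \<le> (real (2 ^ n))\<^sup>2" using d by (intro power_mono) (simp_all add: 3)
    then have e: "e \<ge> 16" by (simp add: e_def)
    have D: "real (2 ^ n) ^ 4 = e * e" "real (2 ^ n) ^ 6 = e * e * e" by (simp_all add: e_def flip: power_add)
    \<comment> \<open>On qubits every phase point satisfies 2a = 0, so \<kappa> = 4^n = d^2.\<close>
    have k: "(if even (2::nat) then 4 else 1) ^ n = e" by (simp add: e_def power_mult[symmetric] mult.commute[of n]) (simp add: power_mult)
    have "(\<integral>U. H2 2 n U \<partial>M) = 1 - (e * e + 2 * e * (e - 3) * (e - 1) / (e - 4) - 4 * (e - 1) * e / (e - 4)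
        + (e - 1)\<^sup>2 * e * (e * e - 8 * e + 6) / ((e - 1) * (e - 4) * (e - 9))) / (e * e * e)"
      using expected_H2_ge_4[OF H d] unfolding D e_def[symmetric] k .
    also have "\<dots> = 1 - 4 * (e * e - 9 * e + 6) / (e * e * (e - 9))"
      using e by (simp add: divide_simps power2_eq_square) (simp add: algebra_simps)
    finally show ?thesis unfolding D e_def[symmetric] .
  qed
qed

section \<open>The bound of order 1/d^2\<close>

lemma abs_frac_le:
  fixes e N Q :: real
  assumes "e > 0" "Q > 0" "0 \<le> N" "N \<le> 6 * Q"
  shows "\<bar>- (N / (e * Q))\<bar> \<le> 6 / e"
proof -
  have "N / (e * Q) \<le> 6 * Q / (e * Q)" using assms by (intro divide_right_mono) auto
  then show ?thesis using assms by simp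
qed

text \<open>The deviation from 1 behaves like 3/e in the single-qudit cases and 4/e for qubits. The
  constant 6 leaves enough slack for all larger dimensions to follow from an inequality linear in
  \<open>e\<close> and \<open>s = e * e\<close>, and it also covers the small values of
  \<open>e\<close> one by one.\<close>

lemma expected_H2_bound:
  assumes d: "(n = 1 \<and> L > 0) \<or> L = 2" and H: "haar_measure (L ^ n) M"
  shows "\<bar>(\<integral>U. H2 L n U \<partial>M) - 1\<bar> \<le> 6 / real (L ^ n) ^ 2"
proof -
  define e where "e = (real (L ^ n))\<^sup>2"
  have D: "real (L ^ n) ^ 4 = e * e" by (simp add: e_def flip: power_add)
  have L: "L ^ n > 0" using d by auto
  have cases_e: "e = 1 \<or> e = 4 \<or> e = 9 \<or> e \<ge> 16"
  proof -
    consider "L ^ n = 1" | "L ^ n = 2" | "L ^ n = 3" | "L ^ n \<ge> 4" using L by linarith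
    then show ?thesis
    proof cases
      case 4
      then have "real 4 \<le> real (L ^ n)" by (simp only: of_nat_le_iff)
      then have "(4::real)\<^sup>2 \<le> (real (L ^ n))\<^sup>2" by (intro power_mono) auto
      then show ?thesis by (simp add: e_def)
    qed (auto simp: e_def simp del: of_nat_power)
  qed
  consider "n = 1" "odd L" | "n = 1" "even L" "L > 0" | "L = 2" using d by auto
  then have "\<bar>(\<integral>U. H2 L n U \<partial>M) - 1\<bar> \<le> 6 / e"
  proof cases
    case 1
    have ne: "e \<noteq> 4"
    proof
      assume "e = 4"
      then have "real (L ^ n) = 2" using real_sqrt_unique[of "real (L ^ n)" e] by (simp add: e_def)
      then show False using 1 by simp
    qed
    have "(\<integral>U. H2 L n U \<partial>M) - 1 = - (3 * (e * e - 4 * e + 2) / (e * e * (e - 4)))"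
      using expected_H2_odd[of L M] H 1 D by (simp add: e_def)
    moreover have "\<bar>- (3 * (e * e - 4 * e + 2) / (e * (e * (e - 4))))\<bar> \<le> 6 / e" if "e \<ge> 9"
    proof -
      define s where "s = e * e"
      have q: "9 * e \<le> s" unfolding s_def using that by (intro mult_right_mono) auto
      have d: "e * (e - 4) = s - 4 * e" by (simp add: s_def algebra_simps)
      show ?thesis by (rule abs_frac_le, unfold d s_def[symmetric], (use that q in argo)+)
    qed
    ultimately show ?thesis using cases_e ne by (auto simp: mult.assoc)
  next
    case 2
    have "(\<integral>U. H2 L n U \<partial>M) - 1 = - (3 * (e * e - 10 * e + 10) / (e * ((e - 9) * (e - 1))))"
      using expected_H2_even[of L M] H 2 D by (simp add: e_def mult.assoc)
    moreover have "\<bar>- (3 * (e * e - 10 * e + 10) / (e * ((e - 9) * (e - 1))))\<bar> \<le> 6 / e" if "e \<ge> 16"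
    proof -
      define s where "s = e * e"
      have q: "16 * e \<le> s" unfolding s_def using that by (intro mult_right_mono) auto
      have d: "(e - 9) * (e - 1) = s - 10 * e + 9" by (simp add: s_def algebra_simps)
      show ?thesis by (rule abs_frac_le, unfold d s_def[symmetric], (use that q in argo)+)
    qed
    \<comment> \<open>An even dimension never gives e = 1 or e = 9. These cases need no refutation:
      a denominator vanishes there, division by zero yields 0, and the bound holds.\<close>
    ultimately show ?thesis using cases_e by auto
  next
    case 3
    have "(\<integral>U. H2 L n U \<partial>M) - 1 = - (4 * (e * e - 9 * e + 6) / (e * (e * (e - 9))))"
      using expected_H2_qubits[of n M] H D unfolding 3 e_def[symmetric, unfolded 3] by (simp add: mult.assoc)
    moreover have "\<bar>- (4 * (e * e - 9 * e + 6) / (e * (e * (e - 9))))\<bar> \<le> 6 / e" if "e \<ge> 16"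
    proof -
      define s where "s = e * e"
      have q: "16 * e \<le> s" unfolding s_def using that by (intro mult_right_mono) auto
      have d: "e * (e - 9) = s - 9 * e" by (simp add: s_def algebra_simps)
      show ?thesis by (rule abs_frac_le, unfold d s_def[symmetric], (use that q in argo)+)
    qed
    ultimately show ?thesis using cases_e by auto
  qed
  then show ?thesis by (simp add: e_def)
qed

theorem theorem8:
  shows
   "(\<forall>d M. odd d \<and> haar_measure d M \<longrightarrow>
       (\<integral>U. H2 d 1 U \<partial>M) =
         1 - 3 * (real d ^ 4 - 4 * real d ^ 2 + 2) / (real d ^ 4 * (real d ^ 2 - 4))) \<and>
    (\<forall>d M. even d \<and> d > 0 \<and> haar_measure d M \<longrightarrow>
       (\<integral>U. H2 d 1 U \<partial>M) =
         1 - 3 * (real d ^ 4 - 10 * real d ^ 2 + 10) /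
               (real d ^ 2 * (real d ^ 2 - 9) * (real d ^ 2 - 1))) \<and>
    (\<forall>n M. haar_measure (2 ^ n) M \<longrightarrow>
       (\<integral>U. H2 2 n U \<partial>M) =
         1 - 4 * (real (2 ^ n) ^ 4 - 9 * real (2 ^ n) ^ 2 + 6) /
               (real (2 ^ n) ^ 4 * (real (2 ^ n) ^ 2 - 9))) \<and>
    (\<exists>C. \<forall>dL n M. ((n = 1 \<and> dL > 0) \<or> dL = 2) \<and> haar_measure (dL ^ n) M \<longrightarrow>
       \<bar>(\<integral>U. H2 dL n U \<partial>M) - 1\<bar> \<le> C / real (dL ^ n) ^ 2)"
  using expected_H2_odd expected_H2_even expected_H2_qubits expected_H2_bound by blast

end
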